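(* Let $L$ be a skew basic $(p,q)$-leaper, $p<q$, $C$ a cycle of $L$ within a $(p+q)\times(p+q)$ chessboard, and $e$ the descent of $C$. Then $C$ is trivial and the direction graph extracted from $C$ depends only on $e$ (that is, cycles of the same descent $e$ of any two skew basic leapers, each within its own board of this kind, have the same extracted direction graph). Equivalently, let $C$ be a cycle of type $k$. Then the direction graph extracted from $C$ depends only on the $k$-th convergent $[c_1\pm,c_2\pm,\ldots,c_k]$ of the even continued fraction representation of $\frac qp$.
   Context: Leapers. A square is a unit square of the infinite chessboard. A $(p,q)$-leaper is a piece that moves from a square $a$ to any of $a+(\pm p,\pm q)$, $a+(\pm q,\pm p)$. The leaper graph of $L$ over a set of squares $B$ has the squares of $B$ as vertices, two being adjacent when a move of $L$ joins them; a cycle of $L$ within $B$ is a simple cycle in this graph. The leaper is basic if $p+q$ is odd and $\gcd(p,q)=1$, and skew if $p,q$ are nonzero and distinct. Frames. Let $m<n$ be coprime positive integers with $m+n$ odd. Identify squares with their centers, the centers being the points of $\mathbb Z^2$. The $(m,n)$-frame $F$ is the set of squares $(x,y)$ with $\frac{n-m}2<\max(|x|,|y|)<\frac{m+n}2$, i.e. an $(m+n)\times(m+n)$ board with an $(n-m)\times(n-m)$ central hole. Its section $F_{\mathtt E}$ consists of the squares with $\frac{n-m}2<x<\frac{m+n}2$, $|y|<\frac{n-m}2$; its section $F_{\mathtt{NE}}$ of those with $\frac{n-m}2<x,y<\frac{m+n}2$; the sections $F_{\mathtt N},F_{\mathtt{NW}},F_{\mathtt W},F_{\mathtt{SW}},F_{\mathtt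 S},F_{\mathtt{SE}}$ are obtained by counterclockwise rotations by multiples of $90^\circ$ about the origin. In the leaper graph of the $(m,n)$-leaper over the $(m+n)\times(m+n)$ board the squares of the hole are isolated and all squares of $F$ have degree two, so a cycle is determined by its vertex set. Lifting. The lifting transformations $\mathtt f,\mathtt g,\mathtt h$ take $S\subseteq F$ to the disjoint union of $(S+v_i)\cap H_i$ over the eight directions $i$, where $H$ is respectively the $(m,2m+n)$-, $(n,2n-m)$-, $(n,m+2n)$-frame, and for $\mathtt f$: $v_{\mathtt E}=(m+n,0)$, $v_{\mathtt{NE}}=(m,m)$; for $\mathtt g$: $v_{\mathtt E}=(n-m,0)$, $v_{\mathtt{NE}}=(n,n)$; for $\mathtt h$: $v_{\mathtt E}=(m+n,0)$, $v_{\mathtt{NE}}=(n,n)$; the other $v_i$ are obtained by $90^\circ$ rotations. Each maps the vertex set of a cycle of the $(m,n)$-leaper within $F$ to the vertex set of a cycle of the leaper with the proportions of $H$ within $H$; this defines the lift of a cycle. Shell. Let $n\le3m$. If $2m\ge n$, the shell of $F$ is the union of eight $(n-m)\times(n-m)$ subboards: the four corners of $F$ and the four adjacent by side to the central hole. If $2m\le n\le3m$, it is the union of eight $(3m-n)\times(3m-n)$ subboards: one in the middle of each outer side and four adjacent by corner to the central hole. (When $n=2m$ both give all of $F$.) The shell is a union of eight-square cycles of the $(m,n)$-leaper, called shell cycles. Descents. The descent of a skew basic $(p,q)$-leaper, $p<q$, is the unique string $e_1\ldots e_l$ of characters $\mathtt f,\mathtt g,\mathtt h$ such that successively applying lifting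 transformations of types $e_l,\ldots,e_1$ to a $(1,2)$-frame gives a $(p,q)$-frame. The descent of a cycle $C$ of $L$ within a $(p+q)\times(p+q)$ board is the prefix $e_1\ldots e_j$ of the descent of $L$ such that $C$ is obtained from a shell cycle (of the frame whose leaper has descent $e_{j+1}\ldots e_l$) by successively applying lifting transformations of types $e_j,\ldots,e_1$. Even continued fractions and types. $[c_1\pm,\ldots,c_K]=c_1\pm\cfrac1{c_2\pm\cfrac1{\ddots\pm\frac1{c_K}}}$, with independent signs, all $c_i$ even integers, $c_1\ge0$, $c_2,\ldots,c_K>0$; every $\frac qp$ with $p,q$ coprime and $p+q$ odd has a unique such representation, and its $k$-th convergent is $[c_1\pm,\ldots,c_k]$ with the same signs. The descent of $L$ is $\mathtt f^{c_1/2-1}x_1\mathtt f^{c_2/2-1}x_2\cdots x_{K-1}\mathtt f^{c_K/2-1}$, where $x_i=\mathtt g$ if the sign following $c_i$ is $-$ and $x_i=\mathtt h$ if it is $+$. A cycle $C$ is of type $k$, $1\le k\le K$, if its descent is $\mathtt f^{c_1/2-1}x_1\cdots x_{k-1}\mathtt f^{c_k/2-1}$. Direction graphs. Let $A_1=\begin{pmatrix}0&1\\1&0\end{pmatrix}$, $A_2=\begin{pmatrix}1&0\\0&1\end{pmatrix}$, $A_3=\begin{pmatrix}-1&0\\0&1\end{pmatrix}$, $A_4=\begin{pmatrix}0&-1\\1&0\end{pmatrix}$, and $A_{i+4}=-A_i$ for $i=1,\ldots,4$. A move of a skew $(p,q)$-leaper, $p<q$, by a translation $v$ has (skew) direction $i\in\{1,\ldots,8\}$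 and direction matrix $A_i$ if $v^T=A_i\binom pq$. A direction graph is a symmetric directed graph whose arcs are labeled with skew directions so that the sum of the associated direction matrices over every simple directed cycle (including two-cycles) is zero. Two direction graphs are the same if there is a label-preserving isomorphism between them. A simple cycle of a skew leaper is trivial if the sum of the direction matrices of its moves (in either orientation) is the zero matrix. The direction graph extracted from a trivial cycle $C$ has the squares of $C$ as vertices and, for each pair of squares $a,b$ consecutive in $C$, an arc from $a$ to $b$ labeled with the direction of the move from $a$ to $b$ and an arc from $b$ to $a$ labeled with the direction of the move from $b$ to $a$. *)

theory Defs
  imports "HOL-Analysis.Analysis"
begin

section \<open>Leapers and cycles\<close>

text \<open>A square is identified with its centre, a point of the integer lattice.\<close>

type_synonym square = "int \<times> int"

definition leaper_moves :: "int \<Rightarrow> int \<Rightarrow> square set" where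
  "leaper_moves p q =
     {(x, y). (\<bar>x\<bar> = p \<and> \<bar>y\<bar> = q) \<or> (\<bar>x\<bar> = q \<and> \<bar>y\<bar> = p)}"

definition basic :: "int \<Rightarrow> int \<Rightarrow> bool" where
  "basic p q \<longleftrightarrow> odd (p + q) \<and> coprime p q"

definition skew :: "int \<Rightarrow> int \<Rightarrow> bool" where
  "skew p q \<longleftrightarrow> p \<noteq> 0 \<and> q \<noteq> 0 \<and> p \<noteq> q"

definition skew_basic :: "int \<Rightarrow> int \<Rightarrow> bool" where
  "skew_basic p q \<longleftrightarrow> 0 \<le> p \<and> p < q \<and> skew p q \<and> basic p q"

text \<open>A closed sequence is given by the list of its successive members, without repeating the
  first one at the end; the last member is followed by the first.\<close>

definition cyclic_pairs :: "'a list \<Rightarrow> ('a \<times> 'a) list" where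
  "cyclic_pairs xs = zip xs (rotate1 xs)"

text \<open>A simple cycle of the leaper graph over \<open>B\<close>, with a starting square and an orientation.\<close>

definition leaper_cycle :: "int \<Rightarrow> int \<Rightarrow> square set \<Rightarrow> square list \<Rightarrow> bool" where
  "leaper_cycle p q B C \<longleftrightarrow>
     3 \<le> length C \<and> distinct C \<and> set C \<subseteq> B \<and>
     (\<forall>(a, b) \<in> set (cyclic_pairs C). b - a \<in> leaper_moves p q)"

text \<open>The board of side \<open>p + q\<close> (odd for a basic leaper) whose central square is \<open>z\<close>.\<close>

definition board :: "int \<Rightarrow> int \<Rightarrow> square \<Rightarrow> square set" where
  "board p q z = {(x, y). 2 * \<bar>x - fst z\<bar> < p + q \<and> 2 * \<bar>y - snd z\<bar> < p + q}"


section \<open>Frames and lifting\<close>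

definition rot :: "square \<Rightarrow> square" where
  "rot = (\<lambda>(x, y). (- y, x))"

definition section_E :: "int \<Rightarrow> int \<Rightarrow> square set" where
  "section_E m n = {(x, y). n - m < 2 * x \<and> 2 * x < m + n \<and> 2 * \<bar>y\<bar> < n - m}"

definition section_NE :: "int \<Rightarrow> int \<Rightarrow> square set" where
  "section_NE m n =
     {(x, y). n - m < 2 * x \<and> 2 * x < m + n \<and> n - m < 2 * y \<and> 2 * y < m + n}"

datatype lift_type = Lf | Lg | Lh

fun lift_params :: "lift_type \<Rightarrow> int \<times> int \<Rightarrow> int \<times> int" where
  "lift_params Lf (m, n) = (m, 2 * m + n)"
| "lift_params Lg (m, n) = (n, 2 * n - m)"
| "lift_params Lh (m, n) = (n, m + 2 * n)"

fun shift_E :: "lift_type \<Rightarrow> int \<times> int \<Rightarrow> square" where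
  "shift_E Lf (m, n) = (m + n, 0)"
| "shift_E Lg (m, n) = (n - m, 0)"
| "shift_E Lh (m, n) = (m + n, 0)"

fun shift_NE :: "lift_type \<Rightarrow> int \<times> int \<Rightarrow> square" where
  "shift_NE Lf (m, n) = (m, m)"
| "shift_NE Lg (m, n) = (n, n)"
| "shift_NE Lh (m, n) = (n, n)"

text \<open>The lift of a set of squares of the frame with parameters \<open>mn\<close>. For \<open>k = 0, 1, 2, 3\<close> the
  two parts below treat the directions E, N, W, S and NE, NW, SW, SE.\<close>

definition lift :: "lift_type \<Rightarrow> int \<times> int \<Rightarrow> square set \<Rightarrow> square set" where
  "lift t mn S =
     (let (m', n') = lift_params t mn in
      \<Union>k\<in>{..<4::nat}.
        (\<lambda>s. s + (rot ^^ k) (shift_E t mn)) ` S \<inter> (rot ^^ k) ` section_E m' n' \<union>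
        (\<lambda>s. s + (rot ^^ k) (shift_NE t mn)) ` S \<inter> (rot ^^ k) ` section_NE m' n')"

text \<open>In a string \<open>[e\<^sub>1, \<dots>, e\<^sub>l]\<close> the transformation \<open>e\<^sub>l\<close> is applied first and \<open>e\<^sub>1\<close> last.\<close>

definition lifts_params :: "lift_type list \<Rightarrow> int \<times> int \<Rightarrow> int \<times> int" where
  "lifts_params es mn = foldr lift_params es mn"

fun lifts :: "lift_type list \<Rightarrow> int \<times> int \<Rightarrow> square set \<Rightarrow> square set" where
  "lifts [] mn S = S"
| "lifts (e # es) mn S = lift e (lifts_params es mn) (lifts es mn S)"


section \<open>Shells and descents\<close>

text \<open>For \<open>n \<le> 2m\<close> the two blocks are the north-eastern corner of the frame and the block
  adjacent by side to the hole on its east; for \<open>2m \<le> n \<le> 3m\<close> they are the middle of the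
  eastern outer side and the block adjacent by corner to the hole on its north-east.\<close>

definition shell :: "int \<Rightarrow> int \<Rightarrow> square set" where
  "shell m n =
     (\<Union>k\<in>{..<4::nat}. (rot ^^ k) `
       (if n \<le> 2 * m then
          {(x, y). 3 * m - n < 2 * x \<and> 2 * x < m + n \<and> 3 * m - n < 2 * y \<and> 2 * y < m + n} \<union>
          {(x, y). n - m < 2 * x \<and> 2 * x < 3 * (n - m) \<and> 2 * \<bar>y\<bar> < n - m}
        else
          {(x, y). 3 * n - 5 * m < 2 * x \<and> 2 * x < m + n \<and> 2 * \<bar>y\<bar> < 3 * m - n} \<union>
          {(x, y). n - m < 2 * x \<and> 2 * x < 5 * m - n \<and> n - m < 2 * y \<and> 2 * y < 5 * m - n}))"

definition shell_cycle :: "int \<Rightarrow> int \<Rightarrow> square list \<Rightarrow> bool" where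
  "shell_cycle m n D \<longleftrightarrow> n \<le> 3 * m \<and> leaper_cycle m n (shell m n) D \<and> length D = 8"

definition leaper_descent :: "int \<Rightarrow> int \<Rightarrow> lift_type list \<Rightarrow> bool" where
  "leaper_descent p q es \<longleftrightarrow> lifts_params es (1, 2) = (p, q)"

text \<open>\<open>cycle_descent p q z C e\<close>: the cycle \<open>C\<close> of the \<open>(p, q)\<close>-leaper within the board centred
  at \<open>z\<close> has descent \<open>e\<close>. The frame of this board is moved to the origin first. Cycles are lifted
  by their vertex sets; all squares of a frame have degree two within the board, so the vertex set
  determines the cycle.\<close>

definition cycle_descent ::
    "int \<Rightarrow> int \<Rightarrow> square \<Rightarrow> square list \<Rightarrow> lift_type list \<Rightarrow> bool" where
  "cycle_descent p q z C e \<longleftrightarrow>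
     (\<exists>d m n D. leaper_descent p q (e @ d) \<and> leaper_descent m n d \<and> shell_cycle m n D \<and>
        (\<lambda>s. s - z) ` set C = lifts e (m, n) (set D))"


section \<open>Even continued fractions and types\<close>

text \<open>The numbers \<open>c\<^sub>1, \<dots>, c\<^sub>K\<close> and the \<open>K - 1\<close> signs (\<open>1\<close> or \<open>-1\<close>) between them are given as
  separate lists.\<close>

fun cf_value :: "int list \<Rightarrow> int list \<Rightarrow> rat" where
  "cf_value (c # cs) (s # ss) = of_int c + of_int s / cf_value cs ss"
| "cf_value (c # cs) [] = of_int c"
| "cf_value [] ss = 0"

definition even_cf :: "int list \<Rightarrow> int list \<Rightarrow> rat \<Rightarrow> bool" where
  "even_cf cs ss r \<longleftrightarrow>
     length cs = Suc (length ss) \<and> set ss \<subseteq> {1, -1} \<and> (\<forall>c \<in> set cs. even c) \<and>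
     0 \<le> hd cs \<and> (\<forall>c \<in> set (tl cs). 0 < c) \<and> cf_value cs ss = r"

definition cf_convergent :: "int list \<Rightarrow> int list \<Rightarrow> nat \<Rightarrow> rat" where
  "cf_convergent cs ss k = cf_value (take k cs) (take (k - 1) ss)"

fun cf_string :: "int list \<Rightarrow> int list \<Rightarrow> lift_type list" where
  "cf_string (c # cs) (s # ss) =
     replicate (nat (c div 2 - 1)) Lf @ (if s = -1 then Lg else Lh) # cf_string cs ss"
| "cf_string (c # cs) [] = replicate (nat (c div 2 - 1)) Lf"
| "cf_string [] ss = []"

text \<open>The cycle \<open>C\<close> is of type \<open>k\<close>, where \<open>cs\<close>, \<open>ss\<close> is the even continued fraction of
  \<open>q / p\<close>.\<close>

definition cycle_of_type ::
    "int \<Rightarrow> int \<Rightarrow> square \<Rightarrow> int list \<Rightarrow> int list \<Rightarrow> square list \<Rightarrow> nat \<Rightarrow> bool" where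
  "cycle_of_type p q z cs ss C k \<longleftrightarrow>
     even_cf cs ss (of_int q / of_int p) \<and> 1 \<le> k \<and> k \<le> length cs \<and>
     cycle_descent p q z C (cf_string (take k cs) (take (k - 1) ss))"


section \<open>Direction graphs\<close>

definition dir_matrix_base :: "nat \<Rightarrow> int^2^2" where
  "dir_matrix_base i =
     (if i = 1 then vector [vector [0, 1], vector [1, 0]]
      else if i = 2 then vector [vector [1, 0], vector [0, 1]]
      else if i = 3 then vector [vector [-1, 0], vector [0, 1]]
      else vector [vector [0, -1], vector [1, 0]])"

text \<open>Meaningful for \<open>1 \<le> i \<le> 8\<close> only.\<close>

definition dir_matrix :: "nat \<Rightarrow> int^2^2" where
  "dir_matrix i = (if i \<le> 4 then dir_matrix_base i else - dir_matrix_base (i - 4))"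

text \<open>For a skew leaper every move has exactly one direction.\<close>

definition direction :: "int \<Rightarrow> int \<Rightarrow> square \<Rightarrow> nat" where
  "direction p q v =
     (THE i. i \<in> {1..8} \<and> (vector [fst v, snd v] :: int^2) = dir_matrix i *v vector [p, q])"

definition trivial_cycle :: "int \<Rightarrow> int \<Rightarrow> square list \<Rightarrow> bool" where
  "trivial_cycle p q C \<longleftrightarrow>
     (\<Sum>(a, b) \<leftarrow> cyclic_pairs C. dir_matrix (direction p q (b - a))) = 0"

text \<open>A set of vertices and a set of arcs \<open>(a, i, b)\<close>, going from \<open>a\<close> to \<open>b\<close> with label \<open>i\<close>.\<close>

type_synonym 'v labelled_digraph = "'v set \<times> ('v \<times> nat \<times> 'v) set"

definition simple_directed_cycle :: "'v labelled_digraph \<Rightarrow> ('v \<times> nat \<times> 'v) list \<Rightarrow> bool" where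
  "simple_directed_cycle G w \<longleftrightarrow>
     w \<noteq> [] \<and> set w \<subseteq> snd G \<and> distinct (map fst w) \<and>
     (\<forall>((a, i, b), (a', i', b')) \<in> set (cyclic_pairs w). b = a')"

definition direction_graph :: "'v labelled_digraph \<Rightarrow> bool" where
  "direction_graph G \<longleftrightarrow>
     snd G \<subseteq> fst G \<times> {1..8} \<times> fst G \<and>
     (\<forall>(a, i, b) \<in> snd G. \<exists>j. (b, j, a) \<in> snd G) \<and>
     (\<forall>w. simple_directed_cycle G w \<longrightarrow> (\<Sum>(a, i, b) \<leftarrow> w. dir_matrix i) = 0)"

definition same_direction_graph :: "'v labelled_digraph \<Rightarrow> 'w labelled_digraph \<Rightarrow> bool" where
  "same_direction_graph G H \<longleftrightarrow>
     (\<exists>\<phi>. bij_betw \<phi> (fst G) (fst H) \<and>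
        (\<forall>a \<in> fst G. \<forall>b \<in> fst G. \<forall>i. (a, i, b) \<in> snd G \<longleftrightarrow> (\<phi> a, i, \<phi> b) \<in> snd H))"

definition extracted_graph :: "int \<Rightarrow> int \<Rightarrow> square list \<Rightarrow> square labelled_digraph" where
  "extracted_graph p q C =
     (set C,
      {(a, direction p q (b - a), b) | a b.
         (a, b) \<in> set (cyclic_pairs C) \<or> (b, a) \<in> set (cyclic_pairs C)})"

end

theory Submission
  imports Defs
begin

text \<open>
  Why the theorem is true. Every square of the board outside the central hole has exactly two moves
  that stay on the board, and which two depends only on the section of the frame that contains it
  (its \<^emph>\<open>zone\<close>); the eight zones have eight different pairs of moves. So the direction graph of a
  cycle records exactly the zones of its vertices and the adjacency between them.

  Directions are treated as formal integer vectors, that is, as matrices with one row for each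
  coordinate, which become moves when \<open>p\<close> and \<open>q\<close> are substituted. A lifting transformation sends a square
  \<open>s\<close> to the squares \<open>s + v\<^sub>\<tau>\<close>, one for each zone \<open>\<tau>\<close> of the new frame in which this sum lands. The
  central computation (\<open>lifted_step\<close>) concerns a move of direction \<open>\<kappa>\<close> from \<open>s + v\<^sub>\<tau>\<close>. It leads to
  a square \<open>s' + v\<^sub>\<tau>\<^sub>'\<close>, where \<open>s'\<close> is \<open>s\<close> itself or the end of a move from \<open>s\<close>, and the new zone
  \<open>\<tau>'\<close> and the direction of that underlying move are functions of \<open>\<kappa>\<close>, \<open>\<tau>\<close> and the zone of \<open>s\<close>
  alone, not of the size of the frame. Two consequences carry the theorem.

  Triviality. By induction on frames there is a \<^emph>\<open>potential\<close> on the whole board: a function with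
  values in the formal vectors that increases by the direction of each move
  (\<open>potential_exists\<close>). It lifts because the formula for the underlying move is an identity between
  formal vectors, with a unimodular change of basis from \<open>(m, n)\<close> to the parameters of the new frame.
  The induction starts from the degenerate \<open>(0, 1)\<close>-frame, which is empty. The directions
  along any closed walk are differences of potentials and so sum to zero; this gives both the
  triviality of a cycle and the defining property of a direction graph.

  Dependence on the descent. A bijection between sets of squares in two frames that preserves zones
  and commutes with moves lifts to one between the lifted sets (\<open>zone_iso_lift\<close>). Two shell cycles are
  related by such a bijection, whatever their frames: a shell cycle visits each zone exactly once, and
  in an order that does not depend on the frame (\<open>shell_cycle_zones\<close>). Hence cycles with the same
  descent have isomorphic direction graphs. Finally an even continued fraction is determined by its
  value (\<open>cf_value_inject\<close>), since its first entry is the even integer at distance less than one from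
  the value; so equal convergents give equal descents.
\<close>

section \<open>Moves as formal vectors, and zones\<close>

text \<open>A pair of rows \<open>((a, b), (c, d))\<close>, standing for the vector \<open>(a m + b n, c m + d n)\<close> with
  indeterminates \<open>m\<close> and \<open>n\<close>.\<close>
type_synonym formal_vector = "(int \<times> int) \<times> (int \<times> int)"

text \<open>The value of a formal vector at given \<open>m\<close> and \<open>n\<close>.\<close>

definition realize :: "int \<Rightarrow> int \<Rightarrow> formal_vector \<Rightarrow> square" where
  "realize m n = (\<lambda>((a, b), (c, d)). (a * m + b * n, c * m + d * n))"

text \<open>The eight skew directions. The rows of each are those of its direction matrix.\<close>

definition labels :: "formal_vector set" where
  "labels = {((1,0),(0,1)), ((1,0),(0,-1)), ((-1,0),(0,1)), ((-1,0),(0,-1)),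
             ((0,1),(1,0)), ((0,1),(-1,0)), ((0,-1),(1,0)), ((0,-1),(-1,0))}"

text \<open>The position of a coordinate relative to the central strip of width \<open>w\<close>: inside it, or on
  the positive or the negative side.\<close>

definition band :: "int \<Rightarrow> int \<Rightarrow> int" where
  "band w x = (if w < 2 * x then 1 else if 2 * x < - w then -1 else 0)"

text \<open>The section of the frame containing a square, encoded by its direction from the centre:
  \<open>(1, 0)\<close> is E, \<open>(1, 1)\<close> is NE, and so on. The central hole has zone \<open>(0, 0)\<close>.\<close>

definition zone :: "int \<Rightarrow> int \<Rightarrow> square \<Rightarrow> square" where
  "zone m n = (\<lambda>(x, y). (band (n - m) x, band (n - m) y))"

text \<open>The directions that stay on the board from a square of zone \<open>(X, Y)\<close>. A long component (the one
  equal to \<open>\<plusminus>n\<close>) must start outside the central strip and point to its opposite side; a short component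
  may go anywhere except outwards.\<close>

definition exits :: "square \<Rightarrow> formal_vector set" where
  "exits = (\<lambda>(X, Y). {((a, b), (c, d)) \<in> labels.
     if a = 0 then b = - X \<and> c \<noteq> Y else d = - Y \<and> a \<noteq> X})"

lemma realize_add: "realize m n (u + v) = realize m n u + realize m n v"
  by (auto simp: realize_def algebra_simps split: prod.splits)

lemma realize_diff: "realize m n (u - v) = realize m n u - realize m n v"
  by (auto simp: realize_def algebra_simps split: prod.splits)

lemma realize_0: "realize m n 0 = 0"
  by (auto simp: realize_def zero_prod_def)

lemma exits_subset_labels: "exits \<sigma> \<subseteq> labels"
  by (auto simp: exits_def split: prod.splits)

lemma exits_0: "exits 0 = {}"
  by (auto simp: exits_def labels_def zero_prod_def)

lemma mem_board_0: "(x, y) \<in> board m n 0 \<longleftrightarrow> 2 * \<bar>x\<bar> < m + n \<and> 2 * \<bar>y\<bar> < m + n"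
  by (simp add: board_def)

text \<open>The eight zones of the frame, without the hole.\<close>

definition zones :: "square set" where
  "zones = {(1,0), (1,1), (0,1), (-1,1), (-1,0), (-1,-1), (0,-1), (1,-1)}"

lemma zone_cases: "zone m n u = 0 \<or> zone m n u \<in> zones"
  by (auto simp: zone_def band_def zones_def zero_prod_def split: prod.splits)

lemma exits_simps:
  "exits (1,0) = {((0,-1),(1,0)), ((0,-1),(-1,0))}"
  "exits (-1,0) = {((0,1),(1,0)), ((0,1),(-1,0))}"
  "exits (0,1) = {((1,0),(0,-1)), ((-1,0),(0,-1))}"
  "exits (0,-1) = {((1,0),(0,1)), ((-1,0),(0,1))}"
  "exits (1,1) = {((0,-1),(-1,0)), ((-1,0),(0,-1))}"
  "exits (-1,1) = {((0,1),(-1,0)), ((1,0),(0,-1))}"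
  "exits (-1,-1) = {((0,1),(1,0)), ((1,0),(0,1))}"
  "exits (1,-1) = {((0,-1),(1,0)), ((-1,0),(0,1))}"
  by (auto simp: exits_def labels_def)

lemma exits_card: "\<sigma> \<in> zones \<Longrightarrow> \<exists>\<kappa> \<mu>. exits \<sigma> = {\<kappa>, \<mu>}"
  unfolding zones_def by (elim insertE emptyE; simp only: exits_simps; blast)

lemma two_abs_less: "2 * \<bar>x\<bar> < c \<longleftrightarrow> - c < 2 * x \<and> 2 * x < c" for x c :: int
  by auto

text \<open>The two components can be examined separately: from a coordinate on the board, a short step in
  direction \<open>e\<close> leaves the board exactly on side \<open>e\<close>, and a long one stays on it exactly from side \<open>-e\<close>.\<close>

lemma exits_iff:
  assumes "0 < m" "m < n" "odd (m + n)" "u \<in> board m n 0" "\<kappa> \<in> labels"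
  shows "u + realize m n \<kappa> \<in> board m n 0 \<longleftrightarrow> \<kappa> \<in> exits (zone m n u)"
proof -
  obtain x y where u: "u = (x, y)" by fastforce
  have short: "2 * \<bar>w + e * m\<bar> < m + n \<longleftrightarrow> band (n - m) w \<noteq> e"
    and long: "2 * \<bar>w + e * n\<bar> < m + n \<longleftrightarrow> band (n - m) w = - e"
    if "2 * \<bar>w\<bar> < m + n" "e \<in> {-1, 1}" for w e
  proof -
    \<comment> \<open>No centre of a square lies on the boundary of the hole, as \<open>n - m\<close> is odd.\<close>
    have "2 * w \<noteq> n - m" "2 * w \<noteq> - (n - m)"
      using \<open>odd (m + n)\<close> by presburger+
    with that assms(1,2)
    show "2 * \<bar>w + e * m\<bar> < m + n \<longleftrightarrow> band (n - m) w \<noteq> e"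
      and "2 * \<bar>w + e * n\<bar> < m + n \<longleftrightarrow> band (n - m) w = - e"
      unfolding band_def two_abs_less by (auto split: if_splits)
  qed
  obtain X Y where XY: "band (n - m) x = X" "band (n - m) y = Y" by simp
  have xy: "2 * \<bar>x\<bar> < m + n" "2 * \<bar>y\<bar> < m + n"
    using assms(4) unfolding u mem_board_0 by auto
  obtain a b c d where abcd: "\<kappa> = ((a, b), (c, d))" by (metis prod.exhaust)
  consider "a = 0" "d = 0" "b \<in> {-1, 1}" "c \<in> {-1, 1}"
    | "b = 0" "c = 0" "a \<in> {-1, 1}" "d \<in> {-1, 1}"
    using assms(5) unfolding abcd labels_def by auto
  then show ?thesis
  proof cases
    case 1
    have "u + realize m n \<kappa> \<in> board m n 0 \<longleftrightarrow> X = - b \<and> Y \<noteq> c"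
      using long[OF xy(1) 1(3)] short[OF xy(2) 1(4)] 1(1,2)
      unfolding u abcd XY by (simp add: mem_board_0 realize_def)
    also have "\<dots> \<longleftrightarrow> \<kappa> \<in> exits (zone m n u)"
      using assms(5) 1 unfolding u abcd by (auto simp: exits_def zone_def XY)
    finally show ?thesis .
  next
    case 2
    have "u + realize m n \<kappa> \<in> board m n 0 \<longleftrightarrow> Y = - d \<and> X \<noteq> a"
      using long[OF xy(2) 2(4)] short[OF xy(1) 2(3)] 2(1,2)
      unfolding u abcd XY by (auto simp: mem_board_0 realize_def)
    also have "\<dots> \<longleftrightarrow> \<kappa> \<in> exits (zone m n u)"
      using assms(5) 2 unfolding u abcd by (auto simp: exits_def zone_def XY)
    finally show ?thesis .
  qed
qed

section \<open>Lifting one move\<close>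

text \<open>The entry \<open>(a, b)\<close> means that the shift of a zone \<open>(X, Y)\<close> is \<open>a m + b n\<close> times the vector \<open>(X, Y)\<close>;
  corner zones and side zones have different factors.\<close>

fun lift_coeff :: "lift_type \<Rightarrow> bool \<Rightarrow> int \<times> int" where
  "lift_coeff Lf corner = (if corner then (1, 0) else (1, 1))"
| "lift_coeff Lg corner = (if corner then (0, 1) else (-1, 1))"
| "lift_coeff Lh corner = (if corner then (0, 1) else (1, 1))"

text \<open>The translation \<open>v\<^sub>\<tau>\<close> attached to the zone \<open>\<tau>\<close> of the lifted frame, as a formal vector in the
  parameters \<open>(m, n)\<close> of the original one.\<close>

definition lift_vector :: "lift_type \<Rightarrow> square \<Rightarrow> formal_vector" where
  "lift_vector t = (\<lambda>(X, Y). let (a, b) = lift_coeff t (X \<noteq> 0 \<and> Y \<noteq> 0)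
     in ((X * a, X * b), (Y * a, Y * b)))"

text \<open>Substitution of the parameters of the lifted frame, as functions of \<open>(m, n)\<close>, into a row.\<close>

fun expand_row :: "lift_type \<Rightarrow> int \<times> int \<Rightarrow> int \<times> int" where
  "expand_row Lf (a, b) = (a + 2 * b, b)"
| "expand_row Lg (a, b) = (- b, a + 2 * b)"
| "expand_row Lh (a, b) = (b, a + 2 * b)"

text \<open>The inverse substitution. It has integer entries since the substitution is unimodular.\<close>

fun collect_row :: "lift_type \<Rightarrow> int \<times> int \<Rightarrow> int \<times> int" where
  "collect_row Lf (a, b) = (a - 2 * b, b)"
| "collect_row Lg (a, b) = (b + 2 * a, - a)"
| "collect_row Lh (a, b) = (b - 2 * a, a)"

abbreviation "expand t \<equiv> map_prod (expand_row t) (expand_row t)"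
abbreviation "collect t \<equiv> map_prod (collect_row t) (collect_row t)"

lemma realize_expand:
  assumes "lift_params t (m, n) = (M, N)"
  shows "realize m n (expand t \<kappa>) = realize M N \<kappa>"
  using assms by (cases t) (auto simp: realize_def algebra_simps split: prod.splits)

lemma collect_expand: "collect t (expand t \<kappa>) = \<kappa>"
  by (cases t; cases \<kappa>) auto

lemma collect_add: "collect t (u + v) = collect t u + collect t v"
  by (cases t; cases u; cases v) auto

text \<open>One coordinate of the zone reached by a short step \<open>e\<close> in the lifted frame, where \<open>X\<close> is the
  corresponding coordinate of the zone at the start and \<open>X0\<close> that of the zone of the square that was lifted. (A long
  step \<open>e\<close> always ends on side \<open>e\<close>.)\<close>

fun short_step :: "lift_type \<Rightarrow> int \<Rightarrow> int \<Rightarrow> int \<Rightarrow> int" where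
  "short_step Lf e X0 X = (if X = 0 \<and> X0 = e then e else 0)"
| "short_step Lg e X0 X = (if X = 0 then e else X0)"
| "short_step Lh e X0 X = (if X = 0 \<and> X0 \<noteq> - e then e else 0)"

text \<open>The zone reached by direction \<open>\<kappa>\<close> from the lift into zone \<open>\<tau>\<close> of a square of zone \<open>\<sigma>\<close>.\<close>

definition next_zone :: "lift_type \<Rightarrow> square \<Rightarrow> square \<Rightarrow> formal_vector \<Rightarrow> square" where
  "next_zone t = (\<lambda>(X0, Y0) (X, Y) ((a, b), (c, d)).
     if a = 0 then (b, short_step t c Y0 Y) else (short_step t a X0 X, d))"

text \<open>The displacement of the underlying square of the original frame, for that same move.\<close>

definition base_step :: "lift_type \<Rightarrow> square \<Rightarrow> square \<Rightarrow> formal_vector \<Rightarrow> formal_vector" where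
  "base_step t \<sigma> \<tau> \<kappa> = expand t \<kappa> + lift_vector t \<tau> - lift_vector t (next_zone t \<sigma> \<tau> \<kappa>)"

text \<open>One coordinate of the zones whose squares are lifted into a zone with coordinate \<open>X\<close>,
  which is a corner zone or a side zone.\<close>

fun row_zones :: "lift_type \<Rightarrow> bool \<Rightarrow> int \<Rightarrow> int set" where
  "row_zones Lf corner X = (if X = 0 then {-1, 0, 1} else if corner then {X} else {- X})"
| "row_zones Lg corner X = (if X = 0 then {0} else if corner then {0, - X} else {0, X})"
| "row_zones Lh corner X = (if X = 0 then {-1, 0, 1} else if corner then {0, X} else {0, - X})"

text \<open>The zones (possibly the hole) whose squares, translated by \<open>v\<^sub>\<tau>\<close>, land in zone \<open>\<tau>\<close>.\<close>

definition base_zones :: "lift_type \<Rightarrow> square \<Rightarrow> square set" where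
  "base_zones t = (\<lambda>(X, Y). row_zones t (X \<noteq> 0 \<and> Y \<noteq> 0) X \<times> row_zones t (X \<noteq> 0 \<and> Y \<noteq> 0) Y)"

lemma band_range: "band w x = -1 \<or> band w x = 0 \<or> band w x = 1"
  by (simp add: band_def)

lemma band_odd:
  assumes "0 \<le> j"
  shows "band (2 * j + 1) x = 1 \<longleftrightarrow> j < x"
    and "band (2 * j + 1) x = -1 \<longleftrightarrow> x < - j"
    and "band (2 * j + 1) x = 0 \<longleftrightarrow> - j \<le> x \<and> x \<le> j"
  using assms by (auto simp: band_def)

lemma board_odd: "2 * \<bar>x\<bar> < 2 * k + 1 \<longleftrightarrow> - k \<le> x \<and> x \<le> k" for x k :: int
  by auto

text \<open>Here \<open>2 j + 1\<close> and \<open>2 k + 1\<close> are the sides of the hole and of the board. In terms of \<open>j\<close> and \<open>k\<close> all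
  conditions on squares become weak inequalities between integers, without parity conditions.\<close>

lemma half_widths:
  fixes m n :: int
  assumes "0 \<le> m" "m < n" "odd (m + n)"
  obtains j k where "0 \<le> j" "j \<le> k" "m = k - j" "n = k + j + 1"
proof
  show "0 \<le> (n - m) div 2" "(n - m) div 2 \<le> (m + n) div 2"
    using assms by (auto intro: zdiv_mono1)
  show "m = (m + n) div 2 - (n - m) div 2" "n = (m + n) div 2 + (n - m) div 2 + 1"
    using assms by presburger+
qed

lemma lift_half_widths:
  assumes "lift_params t (k - j, k + j + 1) = (M, N)"
  shows "N - M = 2 * (if t = Lg then j else k) + 1"
    "M + N = 2 * (case t of Lf \<Rightarrow> 2 * k - j | Lg \<Rightarrow> k + 2 * j + 1 | Lh \<Rightarrow> 2 * k + j + 1) + 1"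
    "M = (if t = Lf then k - j else k + j + 1)"
  using assms by (cases t; auto)+

lemma row_lift:
  assumes "0 \<le> m" "m < n" "odd (m + n)" and MN: "lift_params t (m, n) = (M, N)"
    and X: "X \<in> {-1, 0, 1}" "corner \<Longrightarrow> X \<noteq> 0"
  defines "v \<equiv> X * fst (lift_coeff t corner) * m + X * snd (lift_coeff t corner) * n"
  shows "2 * \<bar>x\<bar> < m + n \<and> band (n - m) x \<in> row_zones t corner X \<longleftrightarrow>
    2 * \<bar>x + v\<bar> < M + N \<and> band (N - M) (x + v) = X"
proof -
  obtain j k where jk: "0 \<le> j" "j \<le> k" "m = k - j" "n = k + j + 1"
    using assms(1-3) by (rule half_widths)
  have k: "0 \<le> k" using jk by simp
  have w: "n - m = 2 * j + 1" "m + n = 2 * k + 1" unfolding jk(3,4) by simp_all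
  note W = lift_half_widths[OF MN[unfolded jk(3,4)]]
  have v: "v = X * fst (lift_coeff t corner) * (k - j) + X * snd (lift_coeff t corner) * (k + j + 1)"
    unfolding v_def jk(3,4) ..
  show ?thesis using X jk(1,2) k band_range[of "2 * j + 1" x] unfolding w W(1,2) board_odd v
    by - (cases t; cases corner; elim insertE emptyE; simp; auto simp: band_odd[OF jk(1)] band_odd[OF k])
qed

lemma row_step:
  assumes "0 \<le> m" "m < n" "odd (m + n)" and MN: "lift_params t (m, n) = (M, N)"
    and X: "X \<in> {-1, 0, 1}" "corner \<Longrightarrow> X \<noteq> 0" and e: "e \<in> {-1, 1}"
    and x: "2 * \<bar>x\<bar> < m + n" "band (n - m) x \<in> row_zones t corner X"
  defines "v \<equiv> X * fst (lift_coeff t corner) * m + X * snd (lift_coeff t corner) * n"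
  shows "e \<noteq> X \<Longrightarrow> (X \<noteq> 0 \<Longrightarrow> corner) \<Longrightarrow> band (N - M) (x + v + e * M) = short_step t e (band (n - m) x) X"
    and "e = - X \<Longrightarrow> band (N - M) (x + v + e * N) = e"
proof -
  obtain j k where jk: "0 \<le> j" "j \<le> k" "m = k - j" "n = k + j + 1"
    using assms(1-3) by (rule half_widths)
  have k: "0 \<le> k" using jk by simp
  have w: "n - m = 2 * j + 1" "m + n = 2 * k + 1" unfolding jk(3,4) by simp_all
  note W = lift_half_widths[OF MN[unfolded jk(3,4)]]
  have v: "v = X * fst (lift_coeff t corner) * (k - j) + X * snd (lift_coeff t corner) * (k + j + 1)"
    unfolding v_def jk(3,4) ..
  have N: "N = M + (2 * (if t = Lg then j else k) + 1)" using W(1) by linarith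
  note * = X(1) e X(2) jk(1,2) k x[unfolded w board_odd]
  show "band (N - M) (x + v + e * M) = short_step t e (band (n - m) x) X"
    if "e \<noteq> X" "X \<noteq> 0 \<Longrightarrow> corner"
    using * that band_range[of "2 * j + 1" x] unfolding w W(1) board_odd v unfolding W(3)
    by - (cases t; cases corner; elim insertE emptyE disjE; simp; auto simp: band_odd[OF jk(1)] band_odd[OF k])
  show "band (N - M) (x + v + e * N) = e" if "e = - X"
    using * that unfolding w W(1) board_odd v unfolding N W(3)
    by - (cases t; cases corner; elim insertE emptyE disjE; simp; auto simp: band_odd[OF jk(1)] band_odd[OF k])
qed

lemma realize_lift_vector:
  "realize m n (lift_vector t (X, Y)) =
    (X * fst (lift_coeff t (X \<noteq> 0 \<and> Y \<noteq> 0)) * m + X * snd (lift_coeff t (X \<noteq> 0 \<and> Y \<noteq> 0)) * n,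
     Y * fst (lift_coeff t (X \<noteq> 0 \<and> Y \<noteq> 0)) * m + Y * snd (lift_coeff t (X \<noteq> 0 \<and> Y \<noteq> 0)) * n)"
  by (simp add: realize_def lift_vector_def Let_def split: prod.splits)

lemma mem_lift_iff:
  assumes "0 \<le> m" "m < n" "odd (m + n)" and MN: "lift_params t (m, n) = (M, N)"
    and "\<tau> \<in> zones"
  shows "s \<in> board m n 0 \<and> zone m n s \<in> base_zones t \<tau> \<longleftrightarrow>
    s + realize m n (lift_vector t \<tau>) \<in> board M N 0 \<and>
    zone M N (s + realize m n (lift_vector t \<tau>)) = \<tau>"
proof -
  obtain x y X Y where st: "s = (x, y)" "\<tau> = (X, Y)" by fastforce
  then have "X \<in> {-1, 0, 1}" "Y \<in> {-1, 0, 1}"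
    using \<open>\<tau> \<in> zones\<close> by (auto simp: zones_def)
  note X = row_lift[OF assms(1-4) this(1), of "X \<noteq> 0 \<and> Y \<noteq> 0" x]
    and Y = row_lift[OF assms(1-4) this(2), of "X \<noteq> 0 \<and> Y \<noteq> 0" y]
  \<comment> \<open>Both sides split into a condition on each coordinate.\<close>
  show ?thesis
    using X Y unfolding st realize_lift_vector zone_def base_zones_def
    by (auto simp: mem_board_0)
qed

lemma zone_step:
  assumes "0 \<le> m" "m < n" "odd (m + n)" and MN: "lift_params t (m, n) = (M, N)"
    and "\<tau> \<in> zones" and s: "s \<in> board m n 0" "zone m n s \<in> base_zones t \<tau>" and \<kappa>: "\<kappa> \<in> exits \<tau>"
  shows "zone M N (s + realize m n (lift_vector t \<tau>) + realize M N \<kappa>) =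
     next_zone t (zone m n s) \<tau> \<kappa>"
proof -
  obtain x y X Y where st: "s = (x, y)" "\<tau> = (X, Y)" by fastforce
  then have XY: "X \<in> {-1, 0, 1}" "Y \<in> {-1, 0, 1}"
    using \<open>\<tau> \<in> zones\<close> by (auto simp: zones_def)
  let ?corner = "X \<noteq> 0 \<and> Y \<noteq> 0"
  have xy: "2 * \<bar>x\<bar> < m + n" "band (n - m) x \<in> row_zones t ?corner X"
    "2 * \<bar>y\<bar> < m + n" "band (n - m) y \<in> row_zones t ?corner Y"
    using s unfolding st by (auto simp: mem_board_0 zone_def base_zones_def)
  note X = row_step[OF assms(1-4) XY(1) _ _ xy(1,2)]
    and Y = row_step[OF assms(1-4) XY(2) _ _ xy(3,4)]
  obtain a b c d where abcd: "\<kappa> = ((a, b), (c, d))" by (metis prod.exhaust)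
  consider "a = 0" "d = 0" "b \<in> {-1, 1}" "c \<in> {-1, 1}" "b = - X" "c \<noteq> Y"
    | "b = 0" "c = 0" "a \<in> {-1, 1}" "d \<in> {-1, 1}" "d = - Y" "a \<noteq> X"
    using \<kappa> unfolding abcd st exits_def labels_def by (auto split: if_splits)
  then show ?thesis
  proof cases
    case 1
    with X(2)[of b] Y(1)[of c] show ?thesis
      unfolding st realize_lift_vector abcd by (auto simp: zone_def next_zone_def realize_def)
  next
    case 2
    with X(1)[of a] Y(2)[of d] show ?thesis
      unfolding st realize_lift_vector abcd by (auto simp: zone_def next_zone_def realize_def)
  qed
qed

text \<open>A finite computation with formal vectors, independent of the frame: beneath a move in the lifted
  frame, the original square stays where it is or makes a legal move. The squares of the hole have no
  moves, so above them only the first case arises.\<close>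

lemma base_step_cases:
  assumes "\<tau> \<in> zones" and "\<sigma> \<in> base_zones t \<tau>" "\<kappa> \<in> exits \<tau>"
  shows "next_zone t \<sigma> \<tau> \<kappa> \<in> zones \<and> (base_step t \<sigma> \<tau> \<kappa> = 0 \<or> base_step t \<sigma> \<tau> \<kappa> \<in> exits \<sigma>)"
proof -
  have "\<forall>\<tau>\<in>zones. \<forall>\<sigma>\<in>base_zones t \<tau>. \<forall>\<kappa>\<in>exits \<tau>.
    next_zone t \<sigma> \<tau> \<kappa> \<in> zones \<and> (base_step t \<sigma> \<tau> \<kappa> = 0 \<or> base_step t \<sigma> \<tau> \<kappa> \<in> exits \<sigma>)"
    by (cases t) (simp_all add: zones_def base_zones_def exits_simps exits_0[unfolded zero_prod_def]
     next_zone_def base_step_def lift_vector_def zero_prod_def)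
  with assms show ?thesis by blast
qed

lemma odd_lift_params:
  assumes "lift_params t (m, n) = (M, N)" "0 \<le> m" "m < n" "odd (m + n)"
  shows "0 \<le> M" "M < N" "odd (M + N)" "0 < m \<Longrightarrow> 0 < M"
  using assms by (cases t; auto)+

text \<open>The projection of a move to the original frame, collecting the preceding facts. All zones and
  directions involved are determined by \<open>\<sigma>\<close>, \<open>\<tau>\<close> and \<open>\<kappa>\<close>.\<close>

lemma lifted_step:
  assumes frame: "0 \<le> m" "m < n" "odd (m + n)" and MN: "lift_params t (m, n) = (M, N)"
    and u: "u \<in> board M N 0" and \<tau>: "zone M N u = \<tau>" "\<tau> \<in> zones" and \<kappa>: "\<kappa> \<in> exits \<tau>"
    and s: "s = u - realize m n (lift_vector t \<tau>)" and \<sigma>: "\<sigma> = zone m n s"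
  defines "\<tau>' \<equiv> zone M N (u + realize M N \<kappa>)"
  shows "s \<in> board m n 0" "\<sigma> \<in> base_zones t \<tau>"
    and "\<tau>' = next_zone t \<sigma> \<tau> \<kappa>" "\<tau>' \<in> zones"
    and "u + realize M N \<kappa> - realize m n (lift_vector t \<tau>') = s + realize m n (base_step t \<sigma> \<tau> \<kappa>)"
    and "base_step t \<sigma> \<tau> \<kappa> = 0 \<or> base_step t \<sigma> \<tau> \<kappa> \<in> exits \<sigma>"
proof -
  have u': "u = s + realize m n (lift_vector t \<tau>)" by (simp add: s)
  have "s \<in> board m n 0 \<and> \<sigma> \<in> base_zones t \<tau>"
    using mem_lift_iff[OF frame MN \<tau>(2), of s] u \<tau>(1) unfolding u'[symmetric] \<sigma> by blast
  then show 1: "s \<in> board m n 0" "\<sigma> \<in> base_zones t \<tau>" by auto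
  show 2: "\<tau>' = next_zone t \<sigma> \<tau> \<kappa>"
    using zone_step[OF frame MN \<tau>(2) 1(1) _ \<kappa>] 1(2) unfolding u'[symmetric] \<sigma> \<tau>'_def by blast
  show "\<tau>' \<in> zones" "base_step t \<sigma> \<tau> \<kappa> = 0 \<or> base_step t \<sigma> \<tau> \<kappa> \<in> exits \<sigma>"
    using base_step_cases[OF \<tau>(2) 1(2) \<kappa>] 2 by auto
  show "u + realize M N \<kappa> - realize m n (lift_vector t \<tau>') = s + realize m n (base_step t \<sigma> \<tau> \<kappa>)"
    unfolding base_step_def 2 realize_add realize_diff realize_expand[OF MN] by (simp add: s)
qed

section \<open>Potentials\<close>

text \<open>A potential accumulates directions along moves. The squares of the hole have no
  moves and carry arbitrary values.\<close>

definition potential :: "int \<Rightarrow> int \<Rightarrow> (square \<Rightarrow> formal_vector) \<Rightarrow> bool" where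
  "potential m n \<Phi> \<longleftrightarrow> (\<forall>s \<in> board m n 0. \<forall>\<kappa> \<in> exits (zone m n s). \<Phi> (s + realize m n \<kappa>) = \<Phi> s + \<kappa>)"

text \<open>The potential of a lifted square is that of the original one, corrected by the shift and then
  rewritten in the parameters of the lifted frame.\<close>

lemma potential_lift:
  assumes frame: "0 \<le> m" "m < n" "odd (m + n)" and MN: "lift_params t (m, n) = (M, N)"
    and \<Phi>: "potential m n \<Phi>"
  shows "potential M N (\<lambda>u. collect t (\<Phi> (u - realize m n (lift_vector t (zone M N u))) + lift_vector t (zone M N u)))"
  unfolding potential_def
proof (intro ballI)
  fix u \<kappa> assume u: "u \<in> board M N 0" and \<kappa>: "\<kappa> \<in> exits (zone M N u)"
  then have zu: "zone M N u \<in> zones" using zone_cases[of M N u] exits_0 by auto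
  define \<tau> where "\<tau> = zone M N u"
  define s where "s = u - realize m n (lift_vector t \<tau>)"
  define \<sigma> where "\<sigma> = zone m n s"
  define \<tau>' where "\<tau>' = zone M N (u + realize M N \<kappa>)"
  note step = lifted_step[OF frame MN u \<tau>_def[symmetric] _ _ s_def \<sigma>_def, of \<kappa>, folded \<tau>'_def]
  note step = step[OF zu[folded \<tau>_def] \<kappa>[folded \<tau>_def]]
  have "\<Phi> (s + realize m n (base_step t \<sigma> \<tau> \<kappa>)) = \<Phi> s + base_step t \<sigma> \<tau> \<kappa>"
    using step(1,6) \<Phi> unfolding potential_def \<sigma>_def by (auto simp: realize_0)
  then have "\<Phi> (u + realize M N \<kappa> - realize m n (lift_vector t \<tau>')) + lift_vector t \<tau>'
      = \<Phi> s + lift_vector t \<tau> + expand t \<kappa>"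
    unfolding step(5) by (simp add: base_step_def step(3))
  then show "collect t (\<Phi> (u + realize M N \<kappa> - realize m n (lift_vector t (zone M N (u + realize M N \<kappa>)))) +
        lift_vector t (zone M N (u + realize M N \<kappa>))) =
      collect t (\<Phi> (u - realize m n (lift_vector t (zone M N u))) + lift_vector t (zone M N u)) + \<kappa>"
    unfolding \<tau>'_def[symmetric] \<tau>_def[symmetric] s_def[symmetric]
    by (simp only: collect_add collect_expand)
qed

text \<open>Every frame with coprime parameters of odd sum arises from the empty \<open>(0, 1)\<close>-frame by lifting
  transformations; the last one is of type g, h or f according to the position of \<open>n\<close> relative to
  \<open>2 m\<close> and \<open>3 m\<close>.\<close>

lemma frame_induct [consumes 4, case_names base lift]:
  fixes m n :: int
  assumes "0 \<le> m" "m < n" "odd (m + n)" "coprime m n"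
    and base: "P 0 1"
    and lift: "\<And>t m n M N. 0 \<le> m \<Longrightarrow> m < n \<Longrightarrow> odd (m + n) \<Longrightarrow> coprime m n \<Longrightarrow>
      lift_params t (m, n) = (M, N) \<Longrightarrow> P m n \<Longrightarrow> P M N"
  shows "P m n"
  using assms(1-4)
proof (induction "nat n" arbitrary: m n rule: less_induct)
  case less
  show ?case
  proof (cases "m = 0")
    case True
    then show ?thesis using less.prems base by simp
  next
    case False
    then have m: "0 < m" using less.prems by simp
    have "n \<noteq> 3 * m" "n \<noteq> 2 * m + m" using less.prems by auto
    have unit: "is_unit c" if "c dvd m" "c dvd n - 2 * m \<or> c dvd 2 * m - n" for c
    proof -
      have "c dvd 2 * m" using that(1) by simp
      moreover have "c dvd n - 2 * m" using that(2) dvd_diff_commute by blast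
      ultimately have "c dvd n - 2 * m + 2 * m" by (rule dvd_add[rotated])
      then have "c dvd n" by simp
      with that(1) less.prems(4) show ?thesis using coprime_common_divisor by blast
    qed
    have cop: "coprime m (n - 2 * m)" "coprime (n - 2 * m) m" "coprime (2 * m - n) m"
      by (rule coprimeI; use unit in blast)+
    \<comment> \<open>In the first case \<open>n - 2 * m > m\<close>; in the second \<open>n - 2 * m < m\<close>; in the third \<open>2 * m - n < m\<close>.\<close>
    consider "3 * m < n" | "2 * m < n" "n < 3 * m" | "n \<le> 2 * m"
      using \<open>n \<noteq> 3 * m\<close> by linarith
    then show ?thesis
    proof cases
      case 1
      have "P m (n - 2 * m)" using 1 less.prems m cop by (intro less.hyps) auto
      from lift[OF _ _ _ _ _ this, of Lf] 1 less.prems m cop show ?thesis by simp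
    next
      case 2
      have "P (n - 2 * m) m" using 2 less.prems m cop by (intro less.hyps) auto
      from lift[OF _ _ _ _ _ this, of Lh] 2 less.prems m cop show ?thesis by simp
    next
      case 3
      have "P (2 * m - n) m" using 3 less.prems m cop by (intro less.hyps) auto
      from lift[OF _ _ _ _ _ this, of Lg] 3 less.prems m cop show ?thesis by simp
    qed
  qed
qed

lemma potential_exists:
  assumes "0 \<le> m" "m < n" "odd (m + n)" "coprime m n"
  shows "\<exists>\<Phi>. potential m n \<Phi>"
  using assms
proof (induction rule: frame_induct)
  case base
  have "zone 0 1 s = 0" if "s \<in> board 0 1 0" for s
  proof -
    obtain x y where s: "s = (x, y)" by fastforce
    have "2 * \<bar>x\<bar> < 0 + 1" "2 * \<bar>y\<bar> < 0 + 1"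
      using that unfolding s mem_board_0 by auto
    then have "x = 0" "y = 0" by linarith+
    then show ?thesis by (simp add: s zone_def band_def zero_prod_def)
  qed
  then show ?case by (auto simp: potential_def exits_0)
next
  case (lift t m n M N)
  then show ?case using potential_lift by blast
qed

section \<open>Lifting isomorphisms\<close>

text \<open>A bijection between sets of squares of two frames, each closed under legal moves, that preserves
  zones and commutes with moves of every direction.\<close>

definition zone_iso ::
    "int \<Rightarrow> int \<Rightarrow> square set \<Rightarrow> int \<Rightarrow> int \<Rightarrow> square set \<Rightarrow> (square \<Rightarrow> square) \<Rightarrow> bool" where
  "zone_iso m n S m' n' S' \<phi> \<longleftrightarrow>
     S \<subseteq> board m n 0 \<and> S' \<subseteq> board m' n' 0 \<and> bij_betw \<phi> S S' \<and>
     (\<forall>s \<in> S. zone m' n' (\<phi> s) = zone m n s \<and>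
        (\<forall>\<kappa> \<in> exits (zone m n s). s + realize m n \<kappa> \<in> S \<and>
            \<phi> (s + realize m n \<kappa>) = \<phi> s + realize m' n' \<kappa>))"

lemma rot_pow:
  "rot ^^ 0 = (\<lambda>(x, y). (x, y))" "rot ^^ 1 = (\<lambda>(x, y). (- y, x))"
  "rot ^^ 2 = (\<lambda>(x, y). (- x, - y))" "rot ^^ 3 = (\<lambda>(x, y). (y, - x))"
  by (auto simp: rot_def numeral_eq_Suc fun_eq_iff)

lemma mem_image_rot:
  "(x, y) \<in> (rot ^^ 0) ` A \<longleftrightarrow> (x, y) \<in> A" "(x, y) \<in> (rot ^^ 1) ` A \<longleftrightarrow> (y, - x) \<in> A"
  "(x, y) \<in> (rot ^^ 2) ` A \<longleftrightarrow> (- x, - y) \<in> A" "(x, y) \<in> (rot ^^ 3) ` A \<longleftrightarrow> (- y, x) \<in> A"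
  unfolding rot_pow by (force simp: image_iff)+

lemma lessThan_4: "{..<4::nat} = {0, 1, 2, 3}"
  by auto

lemma mem_sections:
  assumes "0 \<le> M" "M < N" "odd (M + N)"
  shows "u \<in> (rot ^^ 0) ` section_E M N \<longleftrightarrow> u \<in> board M N 0 \<and> zone M N u = (1, 0)"
    and "u \<in> (rot ^^ 1) ` section_E M N \<longleftrightarrow> u \<in> board M N 0 \<and> zone M N u = (0, 1)"
    and "u \<in> (rot ^^ 2) ` section_E M N \<longleftrightarrow> u \<in> board M N 0 \<and> zone M N u = (-1, 0)"
    and "u \<in> (rot ^^ 3) ` section_E M N \<longleftrightarrow> u \<in> board M N 0 \<and> zone M N u = (0, -1)"
    and "u \<in> (rot ^^ 0) ` section_NE M N \<longleftrightarrow> u \<in> board M N 0 \<and> zone M N u = (1, 1)"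
    and "u \<in> (rot ^^ 1) ` section_NE M N \<longleftrightarrow> u \<in> board M N 0 \<and> zone M N u = (-1, 1)"
    and "u \<in> (rot ^^ 2) ` section_NE M N \<longleftrightarrow> u \<in> board M N 0 \<and> zone M N u = (-1, -1)"
    and "u \<in> (rot ^^ 3) ` section_NE M N \<longleftrightarrow> u \<in> board M N 0 \<and> zone M N u = (1, -1)"
proof -
  obtain x y where u: "u = (x, y)" by fastforce
  obtain j k where jk: "0 \<le> j" "j \<le> k" "M = k - j" "N = k + j + 1"
    using assms by (rule half_widths)
  have k: "0 \<le> k" using jk by simp
  have w: "N - M = 2 * j + 1" "M + N = 2 * k + 1" unfolding jk(3,4) by simp_all
  note defs = u mem_image_rot section_E_def section_NE_def mem_board_0 zone_def w board_odd
    mem_Collect_eq prod.case prod.inject band_odd[OF jk(1)]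
  show "u \<in> (rot ^^ 0) ` section_E M N \<longleftrightarrow> u \<in> board M N 0 \<and> zone M N u = (1, 0)"
    unfolding defs using jk(1,2) by auto
  show "u \<in> (rot ^^ 1) ` section_E M N \<longleftrightarrow> u \<in> board M N 0 \<and> zone M N u = (0, 1)"
    unfolding defs using jk(1,2) by auto
  show "u \<in> (rot ^^ 2) ` section_E M N \<longleftrightarrow> u \<in> board M N 0 \<and> zone M N u = (-1, 0)"
    unfolding defs using jk(1,2) by auto
  show "u \<in> (rot ^^ 3) ` section_E M N \<longleftrightarrow> u \<in> board M N 0 \<and> zone M N u = (0, -1)"
    unfolding defs using jk(1,2) by auto
  show "u \<in> (rot ^^ 0) ` section_NE M N \<longleftrightarrow> u \<in> board M N 0 \<and> zone M N u = (1, 1)"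
    unfolding defs using jk(1,2) by auto
  show "u \<in> (rot ^^ 1) ` section_NE M N \<longleftrightarrow> u \<in> board M N 0 \<and> zone M N u = (-1, 1)"
    unfolding defs using jk(1,2) by auto
  show "u \<in> (rot ^^ 2) ` section_NE M N \<longleftrightarrow> u \<in> board M N 0 \<and> zone M N u = (-1, -1)"
    unfolding defs using jk(1,2) by auto
  show "u \<in> (rot ^^ 3) ` section_NE M N \<longleftrightarrow> u \<in> board M N 0 \<and> zone M N u = (1, -1)"
    unfolding defs using jk(1,2) by auto
qed

lemma rot_shifts:
  "(rot ^^ 0) (shift_E t (m, n)) = realize m n (lift_vector t (1, 0))"
  "(rot ^^ 1) (shift_E t (m, n)) = realize m n (lift_vector t (0, 1))"
  "(rot ^^ 2) (shift_E t (m, n)) = realize m n (lift_vector t (-1, 0))"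
  "(rot ^^ 3) (shift_E t (m, n)) = realize m n (lift_vector t (0, -1))"
  "(rot ^^ 0) (shift_NE t (m, n)) = realize m n (lift_vector t (1, 1))"
  "(rot ^^ 1) (shift_NE t (m, n)) = realize m n (lift_vector t (-1, 1))"
  "(rot ^^ 2) (shift_NE t (m, n)) = realize m n (lift_vector t (-1, -1))"
  "(rot ^^ 3) (shift_NE t (m, n)) = realize m n (lift_vector t (1, -1))"
  unfolding rot_pow realize_lift_vector by (cases t; simp)+

text \<open>The eight translated parts of a lifted set, described by zones.\<close>

lemma mem_lift:
  assumes frame: "0 \<le> m" "m < n" "odd (m + n)" and MN: "lift_params t (m, n) = (M, N)"
  shows "u \<in> lift t (m, n) S \<longleftrightarrow> u \<in> board M N 0 \<and> zone M N u \<in> zones \<and>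
    u - realize m n (lift_vector t (zone M N u)) \<in> S"
proof -
  have img: "u \<in> (\<lambda>s. s + v) ` S \<longleftrightarrow> u - v \<in> S" for v
    by (metis (no_types, lifting) add_diff_cancel diff_add_cancel image_iff)
  obtain z where z: "zone M N u = z" by simp
  show ?thesis
    unfolding lift_def MN Let_def prod.case lessThan_4 UN_insert UN_empty Un_iff Int_iff Un_empty_right
      mem_sections[OF odd_lift_params(1-3)[OF MN frame]] rot_shifts img z
    by (auto simp: zones_def)
qed

text \<open>The lifted bijection applies the given one to the underlying square and translates the result
  into the same zone as before.\<close>

lemma zone_iso_lift:
  assumes pos: "0 < m" and frame: "0 \<le> m" "m < n" "odd (m + n)" and MN: "lift_params t (m, n) = (M, N)"
    and frame': "0 \<le> m'" "m' < n'" "odd (m' + n')" and MN': "lift_params t (m', n') = (M', N')"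
    and iso: "zone_iso m n S m' n' S' \<phi>"
  shows "\<exists>\<psi>. zone_iso M N (lift t (m, n) S) M' N' (lift t (m', n') S') \<psi>"
proof -
  define v where "v \<tau> = realize m n (lift_vector t \<tau>)" for \<tau>
  define v' where "v' \<tau> = realize m' n' (lift_vector t \<tau>)" for \<tau>
  define \<psi> where "\<psi> u = \<phi> (u - v (zone M N u)) + v' (zone M N u)" for u
  note mem = mem_lift[OF frame MN, folded v_def] and mem' = mem_lift[OF frame' MN', folded v'_def]
  have sub: "S \<subseteq> board m n 0" "S' \<subseteq> board m' n' 0" and bij: "bij_betw \<phi> S S'"
    and \<phi>_zone: "\<And>s. s \<in> S \<Longrightarrow> zone m' n' (\<phi> s) = zone m n s"
    and \<phi>_step: "\<And>s \<kappa>. s \<in> S \<Longrightarrow> \<kappa> \<in> exits (zone m n s) \<Longrightarrow>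
      s + realize m n \<kappa> \<in> S \<and> \<phi> (s + realize m n \<kappa>) = \<phi> s + realize m' n' \<kappa>"
    using iso unfolding zone_iso_def by auto
  have \<phi>_mem: "\<phi> s \<in> S'" if "s \<in> S" for s
    using bij that by (auto simp: bij_betw_def)
  have \<psi>_mem: "\<psi> u \<in> lift t (m', n') S'" and \<psi>_zone: "zone M' N' (\<psi> u) = zone M N u"
    if "u \<in> lift t (m, n) S" for u
  proof -
    define \<tau> where "\<tau> = zone M N u"
    define s where "s = u - v \<tau>"
    have u: "u \<in> board M N 0" "\<tau> \<in> zones" "s \<in> S"
      using that unfolding mem \<tau>_def s_def by auto
    have "zone m n s \<in> base_zones t \<tau>"
      using mem_lift_iff[OF frame MN u(2), of s] u by (simp add: s_def v_def \<tau>_def)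
    then have "\<psi> u \<in> board M' N' 0 \<and> zone M' N' (\<psi> u) = \<tau>"
      using mem_lift_iff[OF frame' MN' u(2), of "\<phi> s"] \<phi>_zone[OF u(3)] \<phi>_mem[OF u(3)] sub(2)
      by (auto simp: \<psi>_def \<tau>_def s_def v'_def)
    then show "\<psi> u \<in> lift t (m', n') S'" "zone M' N' (\<psi> u) = zone M N u"
      using u \<phi>_mem[OF u(3)] unfolding mem' by (auto simp: \<psi>_def \<tau>_def s_def)
  qed
  have "inj_on \<psi> (lift t (m, n) S)"
  proof (rule inj_onI)
    fix a b assume a: "a \<in> lift t (m, n) S" and b: "b \<in> lift t (m, n) S" and eq: "\<psi> a = \<psi> b"
    then have z: "zone M N a = zone M N b" using \<psi>_zone by metis
    then have "\<phi> (a - v (zone M N a)) = \<phi> (b - v (zone M N a))" using eq by (simp add: \<psi>_def)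
    then have "a - v (zone M N a) = b - v (zone M N a)"
      using a b z bij unfolding mem by (metis bij_betw_imp_inj_on inj_onD)
    then show "a = b" by simp
  qed
  moreover have "b \<in> \<psi> ` lift t (m, n) S" if "b \<in> lift t (m', n') S'" for b
  proof -
    define \<tau> where "\<tau> = zone M' N' b"
    have b: "b \<in> board M' N' 0" "\<tau> \<in> zones" "b - v' \<tau> \<in> S'"
      using that unfolding mem' \<tau>_def by auto
    then obtain s where s: "s \<in> S" "\<phi> s = b - v' \<tau>"
      using bij by (auto simp: bij_betw_def)
    have "zone m n s \<in> base_zones t \<tau>"
      using mem_lift_iff[OF frame' MN' b(2), of "\<phi> s"] b(1) s \<phi>_zone[OF s(1)] by (simp add: v'_def \<tau>_def)
    then have "s + v \<tau> \<in> board M N 0 \<and> zone M N (s + v \<tau>) = \<tau>"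
      using mem_lift_iff[OF frame MN b(2), of s] s(1) sub(1) by (auto simp: v_def)
    then have "s + v \<tau> \<in> lift t (m, n) S" "\<psi> (s + v \<tau>) = b"
      using s b(2) unfolding mem by (auto simp: \<psi>_def)
    then show ?thesis by blast
  qed
  ultimately have "bij_betw \<psi> (lift t (m, n) S) (lift t (m', n') S')"
    using \<psi>_mem unfolding bij_betw_def by blast
  moreover have "u + realize M N \<kappa> \<in> lift t (m, n) S \<and> \<psi> (u + realize M N \<kappa>) = \<psi> u + realize M' N' \<kappa>"
    if u: "u \<in> lift t (m, n) S" and \<kappa>: "\<kappa> \<in> exits (zone M N u)" for u \<kappa>
  proof -
    define \<tau> where "\<tau> = zone M N u"
    define s where "s = u - realize m n (lift_vector t \<tau>)"
    define \<sigma> where "\<sigma> = zone m n s"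
    define \<tau>' where "\<tau>' = zone M N (u + realize M N \<kappa>)"
    define K where "K = base_step t \<sigma> \<tau> \<kappa>"
    have mems: "u \<in> board M N 0" "\<tau> \<in> zones" "s \<in> S" "\<kappa> \<in> exits \<tau>"
      using u \<kappa> unfolding mem \<tau>_def s_def v_def by auto
    note step = lifted_step[OF frame MN mems(1) \<tau>_def[symmetric] mems(2,4) s_def \<sigma>_def, folded \<tau>'_def K_def]
    have K: "s + realize m n K \<in> S \<and> \<phi> (s + realize m n K) = \<phi> s + realize m' n' K"
      using step(6) \<phi>_step[OF mems(3), of K] mems(3) unfolding \<sigma>_def by (auto simp: realize_0)
    have "u + realize M N \<kappa> \<in> board M N 0"
      using exits_iff[OF odd_lift_params(4,2,3)[OF MN frame], of u \<kappa>] pos mems exits_subset_labels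
      unfolding \<tau>_def by blast
    moreover have "\<psi> (u + realize M N \<kappa>) = \<psi> u + realize M' N' \<kappa>"
    proof -
      have "\<psi> (u + realize M N \<kappa>) = \<phi> (s + realize m n K) + v' \<tau>'"
        unfolding \<psi>_def \<tau>'_def[symmetric] v_def step(5) ..
      also have "\<dots> = \<phi> s + (realize m' n' K + v' \<tau>')"
        using K by (simp add: add.assoc)
      also have "realize m' n' K + v' \<tau>' = v' \<tau> + realize M' N' \<kappa>"
        unfolding K_def base_step_def step(3)[symmetric] v'_def realize_add realize_diff realize_expand[OF MN']
        by simp
      also have "\<phi> s + (v' \<tau> + realize M' N' \<kappa>) = \<psi> u + realize M' N' \<kappa>"
        unfolding \<psi>_def \<tau>_def[symmetric] s_def v_def by (simp add: add.assoc)
      finally show ?thesis .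
    qed
    ultimately show ?thesis
      using K step(4,5) unfolding mem v_def by (simp add: \<tau>'_def)
  qed
  ultimately have "zone_iso M N (lift t (m, n) S) M' N' (lift t (m', n') S') \<psi>"
    using \<psi>_zone unfolding zone_iso_def by (auto simp: mem mem')
  then show ?thesis by blast
qed

section \<open>Shell cycles\<close>

text \<open>The zone reached from a shell square of zone \<open>(X, Y)\<close>: the long component crosses to the opposite
  side, and the short one moves between the strip of the hole and the outside of it.\<close>

definition shell_next :: "square \<Rightarrow> formal_vector \<Rightarrow> square" where
  "shell_next = (\<lambda>(X, Y) ((a, b), (c, d)).
     if a = 0 then (b, if Y = 0 then c else 0) else (if X = 0 then a else 0, d))"

lemma shell_step:
  assumes "0 < m" "m < n" "odd (m + n)" "n \<le> 3 * m" and u: "u \<in> shell m n"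
  shows "u \<in> board m n 0" "zone m n u \<in> zones"
    and "\<kappa> \<in> exits (zone m n u) \<Longrightarrow> zone m n (u + realize m n \<kappa>) = shell_next (zone m n u) \<kappa>"
proof -
  obtain x y where u_eq: "u = (x, y)" by fastforce
  obtain j k where jk: "0 \<le> j" "j \<le> k" "m = k - j" "n = k + j + 1"
    using half_widths[of m n] assms by (metis less_imp_le)
  have w: "n - m = 2 * j + 1" "m + n = 2 * k + 1" unfolding jk(3,4) by simp_all
  have j: "2 * j + 1 \<le> k" using assms(4) jk by simp
  \<comment> \<open>In a shell square of a side zone one coordinate is \<open>out\<close> and the other \<open>mid\<close>; in one of a corner
    zone both are \<open>cor\<close>. The bounds on a block are chosen so that a long step from \<open>out\<close> ends on the
    opposite side, and a short step leads from \<open>mid\<close> to a side and from \<open>cor\<close> into the strip.\<close>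
  define out where "out e w \<longleftrightarrow> - k \<le> w \<and> w \<le> k \<and> band (2 * j + 1) w = e \<and> band (2 * j + 1) (w - e * n) = - e" for e w
  define mid where "mid w \<longleftrightarrow> - k \<le> w \<and> w \<le> k \<and> band (2 * j + 1) w = 0 \<and>
      band (2 * j + 1) (w + m) = 1 \<and> band (2 * j + 1) (w - m) = - 1" for w
  define cor where "cor e w \<longleftrightarrow> out e w \<and> band (2 * j + 1) (w - e * m) = 0" for e w
  have sgn: "out 1 (- w) \<longleftrightarrow> out (- 1) w" "mid (- w) \<longleftrightarrow> mid w" "cor 1 (- w) \<longleftrightarrow> cor (-1) w" for w
    unfolding out_def mid_def cor_def using band_odd[OF jk(1)] by auto
  let ?R = "\<lambda>(x, y). out 1 x \<and> mid y \<or> cor 1 x \<and> cor 1 y"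
  \<comment> \<open>Up to rotation, the first two blocks form the shell for \<open>n \<le> 2 m\<close>, the last two the one for \<open>2 m < n\<close>.\<close>
  have R: "?R (a, b)" if "(a, b) \<in> (if n \<le> 2 * m then
          {(x, y). 3 * m - n < 2 * x \<and> 2 * x < m + n \<and> 3 * m - n < 2 * y \<and> 2 * y < m + n} \<union>
          {(x, y). n - m < 2 * x \<and> 2 * x < 3 * (n - m) \<and> 2 * \<bar>y\<bar> < n - m}
        else
          {(x, y). 3 * n - 5 * m < 2 * x \<and> 2 * x < m + n \<and> 2 * \<bar>y\<bar> < 3 * m - n} \<union>
          {(x, y). n - m < 2 * x \<and> 2 * x < 5 * m - n \<and> n - m < 2 * y \<and> 2 * y < 5 * m - n})" for a b
    using that j jk(1,2) unfolding prod.case out_def mid_def cor_def jk(3,4) two_abs_less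
    by (auto simp: band_odd[OF jk(1)] split: if_splits)
  have "?R (x, y) \<or> ?R (y, - x) \<or> ?R (- x, - y) \<or> ?R (- y, x)"
    using u R unfolding u_eq shell_def lessThan_4 UN_insert UN_empty Un_empty_right Un_iff mem_image_rot
    by blast
  then have "(\<exists>X \<in> {-1, 1}. out X x \<and> mid y) \<or> (\<exists>Y \<in> {-1, 1}. mid x \<and> out Y y) \<or>
      (\<exists>X \<in> {-1, 1}. \<exists>Y \<in> {-1, 1}. cor X x \<and> cor Y y)"
    unfolding prod.case sgn by blast
  then show "u \<in> board m n 0" "zone m n u \<in> zones"
    and "\<kappa> \<in> exits (zone m n u) \<Longrightarrow> zone m n (u + realize m n \<kappa>) = shell_next (zone m n u) \<kappa>"
    unfolding u_eq mem_board_0 w board_odd zone_def prod.case out_def mid_def cor_def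
    by (auto simp: zones_def exits_simps realize_def shell_next_def)
qed

text \<open>Moves along the shell run through the zones in the cyclic order E, NW, S, NE, W, SE, N, SW.\<close>

lemma shell_next_reaches:
  assumes "Z \<subseteq> zones" "Z \<noteq> {}" "\<And>\<sigma> \<kappa>. \<sigma> \<in> Z \<Longrightarrow> \<kappa> \<in> exits \<sigma> \<Longrightarrow> shell_next \<sigma> \<kappa> \<in> Z"
  shows "Z = zones"
proof -
  have steps: "(1, 0) \<in> Z \<Longrightarrow> (-1, 1) \<in> Z" "(-1, 1) \<in> Z \<Longrightarrow> (0, -1) \<in> Z"
    "(0, -1) \<in> Z \<Longrightarrow> (1, 1) \<in> Z" "(1, 1) \<in> Z \<Longrightarrow> (-1, 0) \<in> Z" "(-1, 0) \<in> Z \<Longrightarrow> (1, -1) \<in> Z"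
    "(1, -1) \<in> Z \<Longrightarrow> (0, 1) \<in> Z" "(0, 1) \<in> Z \<Longrightarrow> (-1, -1) \<in> Z" "(-1, -1) \<in> Z \<Longrightarrow> (1, 0) \<in> Z"
    using assms(3)[of "(1, 0)" "((0,-1),(1,0))"] assms(3)[of "(-1, 1)" "((1,0),(0,-1))"]
      assms(3)[of "(0, -1)" "((1,0),(0,1))"] assms(3)[of "(1, 1)" "((0,-1),(-1,0))"]
      assms(3)[of "(-1, 0)" "((0,1),(-1,0))"] assms(3)[of "(1, -1)" "((-1,0),(0,1))"]
      assms(3)[of "(0, 1)" "((-1,0),(0,-1))"] assms(3)[of "(-1, -1)" "((0,1),(1,0))"]
    by (simp_all add: shell_next_def exits_simps)
  obtain \<sigma> where "\<sigma> \<in> Z" "\<sigma> \<in> zones" using assms(1,2) by blast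
  then have "(1, 0) \<in> Z" unfolding zones_def using steps by blast
  then have "zones \<subseteq> Z" unfolding zones_def using steps by blast
  with assms(1) show ?thesis by blast
qed
section \<open>Cycles on the board\<close>

lemma leaper_moves_eq:
  assumes "0 \<le> p" "0 \<le> q"
  shows "leaper_moves p q = realize p q ` labels"
proof (rule set_eqI)
  fix v :: square
  obtain x y where v: "v = (x, y)" by fastforce
  have abs: "\<bar>w\<bar> = c \<longleftrightarrow> w = c \<or> w = - c" if "0 \<le> c" for w c :: int
    using that by linarith
  show "v \<in> leaper_moves p q \<longleftrightarrow> v \<in> realize p q ` labels"
    unfolding v leaper_moves_def labels_def image_insert image_empty realize_def
    by (simp add: abs[OF assms(1)] abs[OF assms(2)]) blast
qed

lemma inj_on_realize:
  assumes "0 < p" "p < q"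
  shows "inj_on (realize p q) labels"
  unfolding labels_def inj_on_def realize_def using assms by simp

lemma uminus_labels: "\<kappa> \<in> labels \<Longrightarrow> - \<kappa> \<in> labels"
  by (auto simp: labels_def)

lemma cyclic_neighbours:
  assumes "3 \<le> length C" "distinct C" "a \<in> set C"
  obtains b c where "b \<noteq> c" "(a, b) \<in> set (cyclic_pairs C)" "(c, a) \<in> set (cyclic_pairs C)"
proof -
  let ?n = "length C"
  obtain i where i: "i < ?n" "a = C ! i" using assms(3) by (metis in_set_conv_nth)
  \<comment> \<open>The index before \<open>i\<close>, cyclically. It differs from the one after \<open>i\<close> since the length is not 2.\<close>
  define h where "h = (if i = 0 then ?n - 1 else i - 1)"
  have h: "h < ?n" "Suc h mod ?n = i" using i(1) by (auto simp: h_def)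
  have pair: "(C ! g, C ! (Suc g mod ?n)) \<in> set (cyclic_pairs C)" if "g < ?n" for g
    using that by (auto simp: cyclic_pairs_def set_zip nth_rotate1)
  have "Suc i mod ?n \<noteq> h"
  proof (cases "Suc i < ?n")
    case True
    then show ?thesis using assms(1) by (auto simp: h_def)
  next
    case False
    then have "Suc i = ?n" using i(1) by simp
    then show ?thesis using assms(1) by (auto simp: h_def)
  qed
  moreover have "Suc i mod ?n < ?n" using i(1) by (metis gr_implies_not0 mod_less_divisor neq0_conv)
  ultimately have "C ! (Suc i mod ?n) \<noteq> C ! h"
    using assms(2) h(1) by (simp add: nth_eq_iff_index_eq)
  then show thesis using that pair[OF i(1)] pair[OF h(1)] i(2) h(2) by metis
qed

lemma cyclic_pairs_mem:
  assumes "(a, b) \<in> set (cyclic_pairs C)"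
  shows "a \<in> set C" "b \<in> set C"
  using assms unfolding cyclic_pairs_def by (auto dest: set_zip_leftD set_zip_rightD)

lemma board_translate: "a \<in> board p q z \<longleftrightarrow> a - z \<in> board p q 0"
  by (cases a; cases z) (simp add: board_def)

text \<open>A vertex of a cycle has two distinct neighbours in it and exactly two legal moves, so every legal
  move from it leads along the cycle.\<close>

lemma cycle_exit_pair:
  assumes pq: "0 < p" "p < q" "odd (p + q)"
    and C: "leaper_cycle p q (board p q z) C" and a: "a \<in> set C" and \<kappa>: "\<kappa> \<in> exits (zone p q (a - z))"
  shows "(a, a + realize p q \<kappa>) \<in> set (cyclic_pairs C) \<or> (a + realize p q \<kappa>, a) \<in> set (cyclic_pairs C)"
proof -
  let ?E = "exits (zone p q (a - z))"
  have len: "3 \<le> length C" "distinct C" and sub: "set C \<subseteq> board p q z"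
    and move: "\<And>a b. (a, b) \<in> set (cyclic_pairs C) \<Longrightarrow> b - a \<in> leaper_moves p q"
    using C unfolding leaper_cycle_def by auto
  obtain b c where bc: "b \<noteq> c" "(a, b) \<in> set (cyclic_pairs C)" "(c, a) \<in> set (cyclic_pairs C)"
    using cyclic_neighbours[OF len a] .
  have moves: "leaper_moves p q = realize p q ` labels" using leaper_moves_eq pq by simp
  have exit: "\<mu> \<in> ?E" if "\<mu> \<in> labels" "a + realize p q \<mu> \<in> set C" for \<mu>
  proof -
    have "a - z \<in> board p q 0" "a + realize p q \<mu> - z \<in> board p q 0"
      using a that(2) sub board_translate by blast+
    moreover have "a + realize p q \<mu> - z = a - z + realize p q \<mu>" by simp
    ultimately have "a - z \<in> board p q 0" "a - z + realize p q \<mu> \<in> board p q 0" by metis+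
    then show ?thesis using exits_iff[OF pq _ that(1)] by blast
  qed
  obtain \<mu> where \<mu>: "\<mu> \<in> labels" "b = a + realize p q \<mu>"
    using move[OF bc(2)] unfolding moves by (auto simp: algebra_simps)
  obtain \<nu> where \<nu>: "\<nu> \<in> labels" "a = c + realize p q \<nu>"
    using move[OF bc(3)] unfolding moves by (auto simp: algebra_simps)
  have c: "c = a + realize p q (- \<nu>)"
    using \<nu>(2) realize_diff[of p q 0 \<nu>] by (simp add: realize_0)
  have "\<mu> \<in> ?E" "- \<nu> \<in> ?E"
    using exit[OF \<mu>(1)] exit[OF uminus_labels[OF \<nu>(1)]] \<mu>(2) c cyclic_pairs_mem[OF bc(2)] cyclic_pairs_mem[OF bc(3)]
    by auto
  moreover have "\<mu> \<noteq> - \<nu>" using bc(1) \<mu>(2) c by auto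
  moreover have "zone p q (a - z) \<in> zones"
    using zone_cases[of p q "a - z"] \<kappa> by (auto simp: exits_0)
  then obtain \<alpha> \<beta> where "?E = {\<alpha>, \<beta>}" using exits_card by metis
  ultimately have "\<kappa> = \<mu> \<or> \<kappa> = - \<nu>" using \<kappa> by auto
  then show ?thesis using bc \<mu>(2) c by auto
qed

lemma cyclic_pair_exit:
  assumes pq: "0 < p" "p < q" "odd (p + q)"
    and C: "leaper_cycle p q (board p q z) C"
    and ab: "(a, b) \<in> set (cyclic_pairs C) \<or> (b, a) \<in> set (cyclic_pairs C)"
  shows "\<exists>\<kappa> \<in> exits (zone p q (a - z)). b = a + realize p q \<kappa>"
proof -
  have mem: "a \<in> set C" "b \<in> set C" using ab cyclic_pairs_mem by metis+
  then have board: "a - z \<in> board p q 0" "b - z \<in> board p q 0"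
    using C board_translate unfolding leaper_cycle_def by blast+
  have "b - a \<in> leaper_moves p q \<or> a - b \<in> leaper_moves p q"
    using C ab unfolding leaper_cycle_def by auto
  then obtain \<kappa> where \<kappa>: "\<kappa> \<in> labels" "b - a = realize p q \<kappa>"
  proof
    assume "b - a \<in> leaper_moves p q"
    then show thesis using that leaper_moves_eq[of p q] pq by auto
  next
    assume "a - b \<in> leaper_moves p q"
    then obtain \<mu> where \<mu>: "\<mu> \<in> labels" "a - b = realize p q \<mu>"
      using leaper_moves_eq[of p q] pq by auto
    have "realize p q (- \<mu>) = - realize p q \<mu>"
      using realize_diff[of p q 0 \<mu>] by (simp add: realize_0)
    then have "b - a = realize p q (- \<mu>)" using \<mu>(2) by (metis minus_diff_eq)
    then show thesis using that uminus_labels[OF \<mu>(1)] by blast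
  qed
  then have b: "b = a + realize p q \<kappa>" by (simp add: algebra_simps)
  moreover have "a - z + realize p q \<kappa> = a + realize p q \<kappa> - z" by simp
  ultimately have "a - z + realize p q \<kappa> \<in> board p q 0" using board(2) by metis
  then show ?thesis using exits_iff[OF pq board(1) \<kappa>(1)] b by blast
qed

section \<open>Direction numbers and extracted graphs\<close>

text \<open>The rows of a direction matrix, as a formal vector.\<close>

definition matrix_label :: "int^2^2 \<Rightarrow> formal_vector" where
  "matrix_label A = ((A $ 1 $ 1, A $ 1 $ 2), (A $ 2 $ 1, A $ 2 $ 2))"

lemma matrix_label_add: "matrix_label (A + B) = matrix_label A + matrix_label B"
  by (simp add: matrix_label_def)

lemma matrix_label_0_iff: "matrix_label A = 0 \<longleftrightarrow> A = 0"
  by (simp add: matrix_label_def zero_prod_def vec_eq_iff forall_2)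

lemma matrix_label_sum_list: "matrix_label (sum_list (map f xs)) = (\<Sum>x\<leftarrow>xs. matrix_label (f x))"
  by (induction xs) (simp_all add: matrix_label_add matrix_label_0_iff)

lemma realize_matrix_label:
  "(vector [fst v, snd v] :: int^2) = A *v vector [p, q] \<longleftrightarrow> v = realize p q (matrix_label A)"
  by (cases v) (simp add: vec_eq_iff forall_2 matrix_vector_mult_def sum_2 realize_def matrix_label_def)

lemma matrix_label_dir_matrix:
  "map (matrix_label \<circ> dir_matrix) [1..<9] =
    [((0,1),(1,0)), ((1,0),(0,1)), ((-1,0),(0,1)), ((0,-1),(1,0)),
     ((0,-1),(-1,0)), ((-1,0),(0,-1)), ((1,0),(0,-1)), ((0,1),(-1,0))]"
  by (simp add: upt_rec dir_matrix_def dir_matrix_base_def matrix_label_def)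

lemma bij_dir_matrix: "bij_betw (matrix_label \<circ> dir_matrix) {1..8} labels"
proof -
  have eq: "{1..8} = set [1..<9::nat]" by auto
  have "inj_on (matrix_label \<circ> dir_matrix) (set [1..<9])"
    by (rule distinct_map[THEN iffD1, THEN conjunct2]) (unfold matrix_label_dir_matrix, simp)
  moreover have "(matrix_label \<circ> dir_matrix) ` set [1..<9] = labels"
    unfolding set_map[symmetric] matrix_label_dir_matrix by (auto simp: labels_def)
  ultimately show ?thesis unfolding eq by (auto simp: bij_betw_def)
qed

text \<open>The number from 1 to 8 of a direction.\<close>

definition label_number :: "formal_vector \<Rightarrow> nat" where
  "label_number = the_inv_into {1..8} (matrix_label \<circ> dir_matrix)"

lemma label_number:
  assumes "\<kappa> \<in> labels"
  shows "label_number \<kappa> \<in> {1..8}" "matrix_label (dir_matrix (label_number \<kappa>)) = \<kappa>"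
proof -
  note inj = bij_betw_imp_inj_on[OF bij_dir_matrix] and img = bij_betw_imp_surj_on[OF bij_dir_matrix]
  show "label_number \<kappa> \<in> {1..8}"
    unfolding label_number_def using the_inv_into_into[OF inj] assms img by blast
  show "matrix_label (dir_matrix (label_number \<kappa>)) = \<kappa>"
    unfolding label_number_def using f_the_inv_into_f[OF inj] assms img by simp
qed

lemma direction_realize:
  assumes "0 < p" "p < q" "\<kappa> \<in> labels"
  shows "direction p q (realize p q \<kappa>) = label_number \<kappa>"
  unfolding direction_def realize_matrix_label
proof (rule the_equality)
  show "label_number \<kappa> \<in> {1..8} \<and> realize p q \<kappa> = realize p q (matrix_label (dir_matrix (label_number \<kappa>)))"
    using label_number[OF assms(3)] by simp
next
  fix i assume i: "i \<in> {1..8} \<and> realize p q \<kappa> = realize p q (matrix_label (dir_matrix i))"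
  then have "matrix_label (dir_matrix i) \<in> labels" using bij_dir_matrix by (auto simp: bij_betw_def)
  then have "matrix_label (dir_matrix i) = \<kappa>"
    using i inj_on_realize[OF assms(1,2)] assms(3) by (auto dest: inj_onD)
  then show "i = label_number \<kappa>"
    using i label_number[OF assms(3)]
      inj_onD[OF bij_betw_imp_inj_on[OF bij_dir_matrix], of i "label_number \<kappa>"] by simp
qed

lemma extracted_arc_iff:
  "(a, i, b) \<in> snd (extracted_graph p q C) \<longleftrightarrow> i = direction p q (b - a) \<and>
    ((a, b) \<in> set (cyclic_pairs C) \<or> (b, a) \<in> set (cyclic_pairs C))"
  by (simp only: extracted_graph_def snd_conv mem_Collect_eq prod.inject) blast

text \<open>The arcs of the extracted graph are determined by the vertex set of the cycle alone.\<close>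

lemma extracted_arcs:
  assumes pq: "0 < p" "p < q" "odd (p + q)" and C: "leaper_cycle p q (board p q z) C"
  shows "(a, i, b) \<in> snd (extracted_graph p q C) \<longleftrightarrow>
    a \<in> set C \<and> (\<exists>\<kappa> \<in> exits (zone p q (a - z)). i = label_number \<kappa> \<and> b = a + realize p q \<kappa>)"
proof -
  have dir: "direction p q (b - a) = label_number \<kappa>"
    if "\<kappa> \<in> exits (zone p q (a - z))" "b = a + realize p q \<kappa>" for \<kappa>
    using direction_realize[OF pq(1,2), of \<kappa>] that exits_subset_labels[of "zone p q (a - z)"] by auto
  have "(a, i, b) \<in> snd (extracted_graph p q C) \<longleftrightarrow> i = direction p q (b - a) \<and>
      ((a, b) \<in> set (cyclic_pairs C) \<or> (b, a) \<in> set (cyclic_pairs C))"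
    by (rule extracted_arc_iff)
  also have "(a, b) \<in> set (cyclic_pairs C) \<or> (b, a) \<in> set (cyclic_pairs C) \<longleftrightarrow>
      a \<in> set C \<and> (\<exists>\<kappa> \<in> exits (zone p q (a - z)). b = a + realize p q \<kappa>)"
    using cyclic_pair_exit[OF pq C, of a b] cycle_exit_pair[OF pq C, of a] cyclic_pairs_mem by metis
  finally show ?thesis using dir by auto
qed

text \<open>Differences telescope around a closed sequence.\<close>

lemma sum_cyclic_pairs:
  fixes \<Psi> :: "'a \<Rightarrow> 'b :: ab_group_add"
  shows "(\<Sum>(a, b)\<leftarrow>cyclic_pairs C. \<Psi> b - \<Psi> a) = 0"
proof -
  have *: "(\<Sum>(a, b)\<leftarrow>zip xs ys. \<Psi> b - \<Psi> a) = sum_list (map \<Psi> ys) - sum_list (map \<Psi> xs)"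
    if "length xs = length ys" for xs ys
    using that by (induction xs ys rule: list_induct2) (auto simp: algebra_simps)
  have "sum_list (map \<Psi> (rotate1 C)) = sum_list (map \<Psi> C)"
    by (cases C) (auto simp: algebra_simps)
  then show ?thesis unfolding cyclic_pairs_def by (subst *) auto
qed

lemma cycle_arc_potential:
  assumes pq: "0 < p" "p < q" "odd (p + q)" and C: "leaper_cycle p q (board p q z) C"
    and \<Phi>: "potential p q \<Phi>" and arc: "(a, i, b) \<in> snd (extracted_graph p q C)"
  shows "matrix_label (dir_matrix i) = \<Phi> (b - z) - \<Phi> (a - z)"
proof -
  obtain \<kappa> where \<kappa>: "a \<in> set C" "\<kappa> \<in> exits (zone p q (a - z))" "i = label_number \<kappa>" "b = a + realize p q \<kappa>"
    using arc extracted_arcs[OF pq C] by auto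
  have "a - z \<in> board p q 0" using \<kappa>(1) C board_translate unfolding leaper_cycle_def by blast
  then have "\<Phi> (a - z + realize p q \<kappa>) = \<Phi> (a - z) + \<kappa>"
    using \<Phi> \<kappa>(2) unfolding potential_def by blast
  moreover have "b - z = a - z + realize p q \<kappa>" using \<kappa>(4) by simp
  ultimately have "\<Phi> (b - z) - \<Phi> (a - z) = \<kappa>" by (metis add_diff_cancel_left')
  then show ?thesis using label_number(2)[of \<kappa>] \<kappa>(2,3) exits_subset_labels[of "zone p q (a - z)"] by auto
qed

lemma cycle_trivial:
  assumes pq: "0 < p" "p < q" "odd (p + q)" and C: "leaper_cycle p q (board p q z) C"
    and \<Phi>: "potential p q \<Phi>"
  shows "trivial_cycle p q C"
proof -
  have "matrix_label (\<Sum>(a, b)\<leftarrow>cyclic_pairs C. dir_matrix (direction p q (b - a))) =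
     (\<Sum>e\<leftarrow>cyclic_pairs C. matrix_label (case e of (a, b) \<Rightarrow> dir_matrix (direction p q (b - a))))"
    by (rule matrix_label_sum_list)
  also have "\<dots> = (\<Sum>(a, b)\<leftarrow>cyclic_pairs C. \<Phi> (b - z) - \<Phi> (a - z))"
  proof (rule arg_cong[where f = sum_list], rule map_cong[OF refl])
    fix e assume e: "e \<in> set (cyclic_pairs C)"
    obtain a b where ab: "e = (a, b)" by (cases e)
    have "(a, direction p q (b - a), b) \<in> snd (extracted_graph p q C)"
      using e by (simp add: extracted_arc_iff ab)
    from cycle_arc_potential[OF pq C \<Phi> this]
    show "matrix_label (case e of (a, b) \<Rightarrow> dir_matrix (direction p q (b - a))) =
        (case e of (a, b) \<Rightarrow> \<Phi> (b - z) - \<Phi> (a - z))"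
      by (simp add: ab)
  qed
  also have "\<dots> = 0" by (rule sum_cyclic_pairs[where \<Psi> = "\<lambda>s. \<Phi> (s - z)"])
  finally show ?thesis unfolding trivial_cycle_def matrix_label_0_iff .
qed

lemma cycle_direction_graph:
  assumes pq: "0 < p" "p < q" "odd (p + q)" and C: "leaper_cycle p q (board p q z) C"
    and \<Phi>: "potential p q \<Phi>"
  shows "direction_graph (extracted_graph p q C)"
proof -
  let ?G = "extracted_graph p q C"
  have sub: "snd ?G \<subseteq> fst ?G \<times> {1..8} \<times> fst ?G"
  proof
    fix e assume e: "e \<in> snd ?G"
    obtain a i b where abi: "e = (a, i, b)" by (cases e)
    then have "a \<in> set C" "b \<in> set C"
      using e cyclic_pairs_mem by (metis extracted_arc_iff)+
    moreover have "i \<in> {1..8}"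
      using e extracted_arcs[OF pq C, of a i b] label_number(1) exits_subset_labels unfolding abi by blast
    ultimately show "e \<in> fst ?G \<times> {1..8} \<times> fst ?G"
      by (simp add: abi extracted_graph_def)
  qed
  have sym: "\<exists>j. (b, j, a) \<in> snd ?G" if "(a, i, b) \<in> snd ?G" for a i b
    using that unfolding extracted_arc_iff by blast
  have "(\<Sum>(a, i, b)\<leftarrow>w. dir_matrix i) = 0" if w: "simple_directed_cycle ?G w" for w
  proof -
    \<comment> \<open>The potential at the source of an arc; its target is the source of the following arc.\<close>
    define \<Psi> where "\<Psi> e = \<Phi> (fst e - z)" for e :: "square \<times> nat \<times> square"
    have arcs: "set w \<subseteq> snd ?G" and chain: "\<And>a i b a' i' b'. ((a, i, b), (a', i', b')) \<in> set (cyclic_pairs w) \<Longrightarrow> b = a'"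
      using w unfolding simple_directed_cycle_def by auto
    have fst: "map fst (cyclic_pairs w) = w" by (simp add: cyclic_pairs_def)
    have "matrix_label (\<Sum>(a, i, b)\<leftarrow>w. dir_matrix i) =
        (\<Sum>e\<leftarrow>w. matrix_label (case e of (a, i, b) \<Rightarrow> dir_matrix i))"
      by (rule matrix_label_sum_list)
    also have "\<dots> = (\<Sum>e\<leftarrow>map fst (cyclic_pairs w). matrix_label (case e of (a, i, b) \<Rightarrow> dir_matrix i))"
      unfolding fst ..
    also have "\<dots> = (\<Sum>(e, e')\<leftarrow>cyclic_pairs w. \<Psi> e' - \<Psi> e)"
      unfolding map_map
    proof (rule arg_cong[where f = sum_list], rule map_cong[OF refl])
      fix ee assume ee: "ee \<in> set (cyclic_pairs w)"
      obtain e e' where "ee = (e, e')" by (cases ee)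
      moreover obtain a i b where "e = (a, i, b)" by (cases e)
      moreover obtain a' i' b' where "e' = (a', i', b')" by (cases e')
      ultimately have eq: "ee = ((a, i, b), (a', i', b'))" by simp
      have "(a, i, b) \<in> snd ?G" using cyclic_pairs_mem(1)[OF ee[unfolded eq]] arcs by (rule rev_subsetD)
      from cycle_arc_potential[OF pq C \<Phi> this] chain[OF ee[unfolded eq]]
      show "((\<lambda>e. matrix_label (case e of (a, i, b) \<Rightarrow> dir_matrix i)) \<circ> fst) ee = (case ee of (e, e') \<Rightarrow> \<Psi> e' - \<Psi> e)"
        by (simp add: eq \<Psi>_def)
    qed
    also have "\<dots> = 0" by (rule sum_cyclic_pairs)
    finally show ?thesis unfolding matrix_label_0_iff .
  qed
  with sub sym show ?thesis unfolding direction_graph_def by blast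
qed

text \<open>The directions out of a square determine its successors, so preserving zones and moves is
  enough to preserve labelled arcs in both senses.\<close>

lemma same_direction_graph_zone_iso:
  assumes pq: "0 < p" "p < q" "odd (p + q)" and C: "leaper_cycle p q (board p q z) C"
    and pq': "0 < p'" "p' < q'" "odd (p' + q')" and C': "leaper_cycle p' q' (board p' q' z') C'"
    and iso: "zone_iso p q ((\<lambda>s. s - z) ` set C) p' q' ((\<lambda>s. s - z') ` set C') \<phi>"
  shows "same_direction_graph (extracted_graph p q C) (extracted_graph p' q' C')"
proof -
  let ?S = "(\<lambda>s. s - z) ` set C" and ?S' = "(\<lambda>s. s - z') ` set C'"
  define \<psi> where "\<psi> a = \<phi> (a - z) + z'" for a
  have bij: "bij_betw \<phi> ?S ?S'"
    and \<phi>_zone: "\<And>s. s \<in> ?S \<Longrightarrow> zone p' q' (\<phi> s) = zone p q s"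
    and \<phi>_step: "\<And>s \<kappa>. s \<in> ?S \<Longrightarrow> \<kappa> \<in> exits (zone p q s) \<Longrightarrow>
      s + realize p q \<kappa> \<in> ?S \<and> \<phi> (s + realize p q \<kappa>) = \<phi> s + realize p' q' \<kappa>"
    using iso unfolding zone_iso_def by auto
  have "bij_betw (\<lambda>s. s - z) (set C) ?S" "bij_betw (\<lambda>s. s + z') ?S' (set C')"
    by (auto simp: bij_betw_def inj_on_def image_image)
  from bij_betw_trans[OF bij_betw_trans[OF this(1) bij] this(2)]
  have bij\<psi>: "bij_betw \<psi> (set C) (set C')" by (simp add: \<psi>_def[abs_def] comp_def)
  have "(a, i, b) \<in> snd (extracted_graph p q C) \<longleftrightarrow> (\<psi> a, i, \<psi> b) \<in> snd (extracted_graph p' q' C')"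
    if a: "a \<in> set C" and b: "b \<in> set C" for a b i
  proof -
    have az: "a - z \<in> ?S" using a by blast
    have zone: "zone p' q' (\<psi> a - z') = zone p q (a - z)" using \<phi>_zone[OF az] by (simp add: \<psi>_def)
    have step: "a + realize p q \<kappa> \<in> set C" "\<psi> (a + realize p q \<kappa>) = \<psi> a + realize p' q' \<kappa>"
      if "\<kappa> \<in> exits (zone p q (a - z))" for \<kappa>
    proof -
      have eq: "a + realize p q \<kappa> - z = a - z + realize p q \<kappa>" by simp
      have "a + realize p q \<kappa> - z \<in> ?S" unfolding eq using \<phi>_step[OF az that] by blast
      then show "a + realize p q \<kappa> \<in> set C" by auto
      show "\<psi> (a + realize p q \<kappa>) = \<psi> a + realize p' q' \<kappa>"
        unfolding \<psi>_def eq using \<phi>_step[OF az that] by simp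
    qed
    have "b = a + realize p q \<kappa> \<longleftrightarrow> \<psi> b = \<psi> a + realize p' q' \<kappa>"
      if "\<kappa> \<in> exits (zone p q (a - z))" for \<kappa>
      using step[OF that] b bij\<psi> by (metis bij_betw_imp_inj_on inj_onD)
    moreover have "\<psi> a \<in> set C'" using bij\<psi> a by (auto simp: bij_betw_def)
    ultimately show ?thesis
      unfolding extracted_arcs[OF pq C] extracted_arcs[OF pq' C'] zone using a by blast
  qed
  then show ?thesis
    unfolding same_direction_graph_def using bij\<psi> by (auto simp: extracted_graph_def)
qed
section \<open>Even continued fractions\<close>

text \<open>The shape of an even continued fraction and of its truncations; the first entry may have any sign.\<close>

definition proper_cf :: "int list \<Rightarrow> int list \<Rightarrow> bool" where
  "proper_cf cs ss \<longleftrightarrow> length cs = Suc (length ss) \<and> set ss \<subseteq> {1, -1} \<and>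
     (\<forall>c \<in> set cs. even c) \<and> (\<forall>c \<in> set (tl cs). 0 < c)"

lemma proper_cf_Cons:
  "proper_cf (c # cs) (s # ss) \<longleftrightarrow> even c \<and> (s = 1 \<or> s = -1) \<and> proper_cf cs ss \<and> 0 < hd cs"
  by (cases cs) (auto simp: proper_cf_def)

lemma proper_cf_Nil: "proper_cf cs [] \<longleftrightarrow> (\<exists>c. cs = [c] \<and> even c)"
  by (cases cs) (auto simp: proper_cf_def)

text \<open>All entries after the first are at least 2, so the value of every tail exceeds 1 and its
  reciprocal is less than 1.\<close>

lemma cf_value_near_hd:
  assumes "proper_cf cs ss"
  shows "\<bar>cf_value cs ss - of_int (hd cs)\<bar> < 1"
  using assms
proof (induction cs ss rule: cf_value.induct)
  case (1 c cs s ss)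
  then have p: "proper_cf cs ss" "0 < hd cs" "s = 1 \<or> s = -1" by (auto simp: proper_cf_Cons)
  then have "even (hd cs)" by (cases cs) (auto simp: proper_cf_def)
  with p(2) have "hd cs \<ge> 2" by presburger
  then have "(2::rat) \<le> of_int (hd cs)" by (metis of_int_le_iff of_int_numeral)
  with 1(1)[OF p(1)] have "1 < cf_value cs ss" by linarith
  then have "\<bar>1 / cf_value cs ss\<bar> < 1" by simp
  with p(3) show ?case by auto
qed (auto simp: proper_cf_def)

lemma even_nearest_unique:
  fixes c c' :: int and v :: "'a :: linordered_idom"
  assumes "even c" "even c'" "\<bar>v - of_int c\<bar> < 1" "\<bar>v - of_int c'\<bar> < 1"
  shows "c = c'"
proof -
  have "\<bar>of_int c - of_int c'\<bar> < (2::'a)" using assms(3,4) by linarith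
  then have "of_int \<bar>c - c'\<bar> < (of_int 2 :: 'a)" by simp
  then have "\<bar>c - c'\<bar> < 2" unfolding of_int_less_iff .
  with assms(1,2) show ?thesis by presburger
qed

lemma even_hd: "proper_cf cs ss \<Longrightarrow> even (hd cs)"
  by (cases cs) (auto simp: proper_cf_def)

lemma cf_value_pos:
  assumes "proper_cf cs ss" "0 < hd cs"
  shows "0 < cf_value cs ss"
proof -
  have "1 \<le> hd cs" using assms(2) by simp
  then have "(1::rat) \<le> of_int (hd cs)" by (metis of_int_le_iff of_int_1)
  then show ?thesis using cf_value_near_hd[OF assms(1)] by linarith
qed

lemma cf_value_inject:
  assumes "proper_cf cs ss" "proper_cf cs' ss'" "cf_value cs ss = cf_value cs' ss'"
  shows "cs = cs' \<and> ss = ss'"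
  using assms
proof (induction ss arbitrary: cs cs' ss')
  case Nil
  have hd: "hd cs = hd cs'"
    using even_nearest_unique[OF even_hd[OF Nil(1)] even_hd[OF Nil(2)] cf_value_near_hd[OF Nil(1)]]
      cf_value_near_hd[OF Nil(2)] Nil(3) by metis
  obtain c where c: "cs = [c]" using Nil(1) by (auto simp: proper_cf_Nil)
  show ?case
  proof (cases ss')
    case Nil
    then show ?thesis using hd c \<open>proper_cf cs' ss'\<close> by (auto simp: proper_cf_Nil)
  next
    case (Cons s' ts')
    moreover obtain ds' where "cs' = c # ds'"
      using hd c Nil(2) by (cases cs') (auto simp: proper_cf_def)
    ultimately show ?thesis
      using Nil(2,3) cf_value_pos[of ds' ts'] c by (auto simp: proper_cf_Cons)
  qed
next
  case (Cons s ts)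
  have hd: "hd cs = hd cs'"
    using even_nearest_unique[OF even_hd[OF Cons(2)] even_hd[OF Cons(3)] cf_value_near_hd[OF Cons(2)]]
      cf_value_near_hd[OF Cons(3)] Cons(4) by metis
  obtain c ds where cs: "cs = c # ds" using Cons(2) by (cases cs) (auto simp: proper_cf_def)
  obtain ds' where cs': "cs' = c # ds'"
    using hd cs Cons(3) by (cases cs') (auto simp: proper_cf_def)
  have p: "proper_cf ds ts" "0 < cf_value ds ts" "s = 1 \<or> s = -1"
    using Cons(2) cf_value_pos[of ds ts] by (auto simp: cs proper_cf_Cons)
  show ?case
  proof (cases ss')
    case Nil
    then show ?thesis using Cons(4) p by (auto simp: cs cs')
  next
    case ss': (Cons s' ts')
    have p': "proper_cf ds' ts'" "0 < cf_value ds' ts'" "s' = 1 \<or> s' = -1"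
      using Cons(3) cf_value_pos[of ds' ts'] by (auto simp: cs' ss' proper_cf_Cons)
    have eq: "of_int s / cf_value ds ts = of_int s' / cf_value ds' ts'"
      using Cons(4) by (simp add: cs cs' ss')
    \<comment> \<open>The tails are positive, so the signs agree.\<close>
    then have cross: "of_int s * cf_value ds' ts' = of_int s' * cf_value ds ts"
      using p(2) p'(2) by (simp add: frac_eq_eq)
    then have "s = s' \<and> cf_value ds ts = cf_value ds' ts'"
      using p(2,3) p'(2,3) by auto
    then show ?thesis using Cons(1)[OF p(1) p'(1)] by (simp add: cs cs' ss')
  qed
qed

lemma proper_cf_take:
  assumes "proper_cf cs ss" "1 \<le> k" "k \<le> length cs"
  shows "proper_cf (take k cs) (take (k - 1) ss)"
proof -
  have "set (tl (take k cs)) \<subseteq> set (tl cs)" by (metis tl_take set_take_subset)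
  then show ?thesis
    using assms set_take_subset[of k cs] set_take_subset[of "k - 1" ss]
    unfolding proper_cf_def by auto
qed

section \<open>Dependence on the descent\<close>

text \<open>The length eight is used here: the vertices meet all eight zones, hence each of them once.\<close>

lemma shell_cycle_zones:
  assumes mn: "0 < m" "m < n" "odd (m + n)" and D: "shell_cycle m n D"
  shows "set D \<subseteq> board m n 0" "bij_betw (zone m n) (set D) zones"
    and "\<And>s \<kappa>. s \<in> set D \<Longrightarrow> \<kappa> \<in> exits (zone m n s) \<Longrightarrow>
      s + realize m n \<kappa> \<in> set D \<and> zone m n (s + realize m n \<kappa>) = shell_next (zone m n s) \<kappa>"
proof -
  have le: "n \<le> 3 * m" and cyc: "leaper_cycle m n (shell m n) D" and len: "length D = 8"
    using D unfolding shell_cycle_def by auto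
  have sub: "set D \<subseteq> shell m n" and dist: "distinct D"
    using cyc unfolding leaper_cycle_def by auto
  note step = shell_step[OF mn le]
  show board: "set D \<subseteq> board m n 0" using sub step(1) by blast
  then have C: "leaper_cycle m n (board m n 0) D" using cyc unfolding leaper_cycle_def by auto
  show next_in: "s + realize m n \<kappa> \<in> set D \<and> zone m n (s + realize m n \<kappa>) = shell_next (zone m n s) \<kappa>"
    if "s \<in> set D" "\<kappa> \<in> exits (zone m n s)" for s \<kappa>
    using cycle_exit_pair[OF mn C that(1), of \<kappa>] step(3)[of s \<kappa>] that sub cyclic_pairs_mem
    by (metis diff_zero subsetD)
  have "zone m n ` set D = zones"
  proof (rule shell_next_reaches)
    show "zone m n ` set D \<subseteq> zones" using sub step(2) by blast
    show "zone m n ` set D \<noteq> {}" using len by (cases D) simp_all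
    fix \<sigma> \<kappa> assume "\<sigma> \<in> zone m n ` set D" "\<kappa> \<in> exits \<sigma>"
    then obtain s where s: "s \<in> set D" "\<kappa> \<in> exits (zone m n s)" "\<sigma> = zone m n s" by blast
    have "zone m n (s + realize m n \<kappa>) \<in> zone m n ` set D" using next_in[OF s(1,2)] by blast
    then show "shell_next \<sigma> \<kappa> \<in> zone m n ` set D" using next_in[OF s(1,2)] s(3) by simp
  qed
  moreover have "card (set D) = card zones"
    using len distinct_card[OF dist] by (simp add: zones_def)
  ultimately show "bij_betw (zone m n) (set D) zones"
    unfolding bij_betw_def by (metis List.finite_set eq_card_imp_inj_on)
qed

lemma shell_cycles_zone_iso:
  assumes mn: "0 < m" "m < n" "odd (m + n)" and D: "shell_cycle m n D"
    and mn': "0 < m'" "m' < n'" "odd (m' + n')" and D': "shell_cycle m' n' D'"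
  shows "\<exists>\<phi>. zone_iso m n (set D) m' n' (set D') \<phi>"
proof -
  note z = shell_cycle_zones[OF mn D] and z' = shell_cycle_zones[OF mn' D']
  note inj' = bij_betw_imp_inj_on[OF z'(2)]
  \<comment> \<open>Each vertex of one cycle is sent to the vertex of the other in the same zone.\<close>
  define \<phi> where "\<phi> = the_inv_into (set D') (zone m' n') \<circ> zone m n"
  have bij: "bij_betw \<phi> (set D) (set D')"
    unfolding \<phi>_def using z(2) bij_betw_the_inv_into[OF z'(2)] by (rule bij_betw_trans)
  have zone: "zone m' n' (\<phi> s) = zone m n s" if "s \<in> set D" for s
    unfolding \<phi>_def comp_def using f_the_inv_into_f_bij_betw[OF z'(2)] z(2) that
    by (meson bij_betw_apply)
  have "\<phi> (s + realize m n \<kappa>) = \<phi> s + realize m' n' \<kappa>"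
    if s: "s \<in> set D" and \<kappa>: "\<kappa> \<in> exits (zone m n s)" for s \<kappa>
  proof -
    have \<phi>s: "\<phi> s \<in> set D'" using bij s by (rule bij_betw_apply)
    have "zone m' n' (\<phi> (s + realize m n \<kappa>)) = zone m' n' (\<phi> s + realize m' n' \<kappa>)"
      using z(3)[OF s \<kappa>] z'(3)[OF \<phi>s, of \<kappa>] zone[OF s] \<kappa> zone[of "s + realize m n \<kappa>"] by simp
    moreover have "\<phi> (s + realize m n \<kappa>) \<in> set D'" "\<phi> s + realize m' n' \<kappa> \<in> set D'"
      using z(3)[OF s \<kappa>] bij bij_betw_apply z'(3)[OF \<phi>s, of \<kappa>] zone[OF s] \<kappa> by (metis, simp)
    ultimately show ?thesis using inj' by (auto dest: inj_onD)
  qed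
  then show ?thesis
    unfolding zone_iso_def using z(1,3) z'(1) bij zone by blast
qed

lemma odd_lifts_params:
  assumes "lifts_params es (m, n) = (M, N)" "0 < m" "m < n" "odd (m + n)"
  shows "0 < M \<and> M < N \<and> odd (M + N)"
  using assms(1)
proof (induction es arbitrary: M N)
  case Nil
  then show ?case using assms(2-4) by (simp add: lifts_params_def)
next
  case (Cons e es)
  obtain M1 N1 where 1: "lifts_params es (m, n) = (M1, N1)" by fastforce
  then have "lift_params e (M1, N1) = (M, N)" using Cons.prems by (simp add: lifts_params_def)
  from odd_lift_params[OF this] Cons.IH[OF 1] show ?case by auto
qed

lemma zone_iso_lifts:
  assumes mn: "0 < m" "m < n" "odd (m + n)" and mn': "0 < m'" "m' < n'" "odd (m' + n')"
    and iso: "zone_iso m n S m' n' S' \<phi>"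
    and "lifts_params es (m, n) = (M, N)" "lifts_params es (m', n') = (M', N')"
  shows "\<exists>\<psi>. zone_iso M N (lifts es (m, n) S) M' N' (lifts es (m', n') S') \<psi>"
  using assms(8-9)
proof (induction es arbitrary: M N M' N')
  case Nil
  then show ?case using iso by (auto simp: lifts_params_def)
next
  case (Cons e es)
  obtain M1 N1 where base: "lifts_params es (m, n) = (M1, N1)" by fastforce
  obtain M1' N1' where base': "lifts_params es (m', n') = (M1', N1')" by fastforce
  have step: "lift_params e (M1, N1) = (M, N)" "lift_params e (M1', N1') = (M', N')"
    using Cons.prems base base' by (simp_all add: lifts_params_def)
  obtain \<psi> where "zone_iso M1 N1 (lifts es (m, n) S) M1' N1' (lifts es (m', n') S') \<psi>"
    using Cons.IH[OF base base'] by blast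
  from zone_iso_lift[OF _ _ _ _ step(1) _ _ _ step(2) this]
    odd_lifts_params[OF base mn] odd_lifts_params[OF base' mn']
  show ?case by (simp add: base base')
qed

lemma skew_basic_frame:
  assumes "skew_basic p q"
  shows "0 < p" "p < q" "odd (p + q)" "coprime p q"
  using assms unfolding skew_basic_def skew_def basic_def by auto

text \<open>The shell cycles underlying the two cycles are related by an isomorphism of zones, which the common
  string of lifting transformations carries to the cycles themselves.\<close>

lemma same_descent_same_graph:
  assumes L: "skew_basic p q" and C: "leaper_cycle p q (board p q z) C"
    and L': "skew_basic p' q'" and C': "leaper_cycle p' q' (board p' q' z') C'"
    and e: "cycle_descent p q z C e" and e': "cycle_descent p' q' z' C' e"
  shows "same_direction_graph (extracted_graph p q C) (extracted_graph p' q' C')"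
proof -
  note pq = skew_basic_frame[OF L] and pq' = skew_basic_frame[OF L']
  obtain d m n D where d: "lifts_params (e @ d) (1, 2) = (p, q)" "lifts_params d (1, 2) = (m, n)"
    "shell_cycle m n D" "(\<lambda>s. s - z) ` set C = lifts e (m, n) (set D)"
    using e unfolding cycle_descent_def leaper_descent_def by blast
  obtain d' m' n' D' where d': "lifts_params (e @ d') (1, 2) = (p', q')" "lifts_params d' (1, 2) = (m', n')"
    "shell_cycle m' n' D'" "(\<lambda>s. s - z') ` set C' = lifts e (m', n') (set D')"
    using e' unfolding cycle_descent_def leaper_descent_def by blast
  have mn: "0 < m" "m < n" "odd (m + n)" and mn': "0 < m'" "m' < n'" "odd (m' + n')"
    using odd_lifts_params[OF d(2)] odd_lifts_params[OF d'(2)] by simp_all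
  have lp: "lifts_params e (m, n) = (p, q)" "lifts_params e (m', n') = (p', q')"
    using d(1,2) d'(1,2) by (simp_all add: lifts_params_def)
  obtain \<phi> where "zone_iso m n (set D) m' n' (set D') \<phi>"
    using shell_cycles_zone_iso[OF mn d(3) mn' d'(3)] by blast
  from zone_iso_lifts[OF mn mn' this lp]
  obtain \<psi> where "zone_iso p q ((\<lambda>s. s - z) ` set C) p' q' ((\<lambda>s. s - z') ` set C') \<psi>"
    unfolding d(4) d'(4) by blast
  from same_direction_graph_zone_iso[OF pq(1-3) C pq'(1-3) C' this] show ?thesis .
qed

lemma same_convergent_same_string:
  assumes "even_cf cs ss r" "1 \<le> k" "k \<le> length cs"
    and "even_cf cs' ss' r'" "1 \<le> k'" "k' \<le> length cs'"
    and "cf_convergent cs ss k = cf_convergent cs' ss' k'"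
  shows "cf_string (take k cs) (take (k - 1) ss) = cf_string (take k' cs') (take (k' - 1) ss')"
proof -
  have "proper_cf cs ss" "proper_cf cs' ss'"
    using assms unfolding even_cf_def proper_cf_def by auto
  then have "take k cs = take k' cs' \<and> take (k - 1) ss = take (k' - 1) ss'"
    using cf_value_inject[OF proper_cf_take proper_cf_take] assms(2,3,5-7)
    unfolding cf_convergent_def by blast
  then show ?thesis by simp
qed

theorem theorem9:
  fixes p q :: int and z :: square and C :: "square list"
  assumes "skew_basic p q"
    and "leaper_cycle p q (board p q z) C"
  shows "trivial_cycle p q C \<and> direction_graph (extracted_graph p q C) \<and>
    (\<forall>(e :: lift_type list) (p' :: int) (q' :: int) (z' :: square) (C' :: square list).
       skew_basic p' q' \<longrightarrow> leaper_cycle p' q' (board p' q' z') C' \<longrightarrow>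
       cycle_descent p q z C e \<longrightarrow> cycle_descent p' q' z' C' e \<longrightarrow>
       same_direction_graph (extracted_graph p q C) (extracted_graph p' q' C')) \<and>
    (\<forall>cs ss k (p' :: int) (q' :: int) (z' :: square) (C' :: square list) cs' ss' k'.
       skew_basic p' q' \<longrightarrow> leaper_cycle p' q' (board p' q' z') C' \<longrightarrow>
       cycle_of_type p q z cs ss C k \<longrightarrow> cycle_of_type p' q' z' cs' ss' C' k' \<longrightarrow>
       cf_convergent cs ss k = cf_convergent cs' ss' k' \<longrightarrow>
       same_direction_graph (extracted_graph p q C) (extracted_graph p' q' C'))"
proof (intro conjI allI impI)
  note pq = skew_basic_frame[OF assms(1)]
  obtain \<Phi> where \<Phi>: "potential p q \<Phi>"
    using potential_exists[of p q] pq by auto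
  show "trivial_cycle p q C" by (rule cycle_trivial[OF pq(1-3) assms(2) \<Phi>])
  show "direction_graph (extracted_graph p q C)" by (rule cycle_direction_graph[OF pq(1-3) assms(2) \<Phi>])
next
  fix e p' q' z' C'
  assume "skew_basic p' q'" "leaper_cycle p' q' (board p' q' z') C'"
    "cycle_descent p q z C e" "cycle_descent p' q' z' C' e"
  then show "same_direction_graph (extracted_graph p q C) (extracted_graph p' q' C')"
    by (rule same_descent_same_graph[OF assms])
next
  fix cs ss k p' q' z' C' cs' ss' k'
  assume L': "skew_basic p' q'" "leaper_cycle p' q' (board p' q' z') C'"
    and types: "cycle_of_type p q z cs ss C k" "cycle_of_type p' q' z' cs' ss' C' k'"
    and conv: "cf_convergent cs ss k = cf_convergent cs' ss' k'"
  have "cf_string (take k cs) (take (k - 1) ss) = cf_string (take k' cs') (take (k' - 1) ss')"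
    using same_convergent_same_string[OF _ _ _ _ _ _ conv] types unfolding cycle_of_type_def by blast
  then show "same_direction_graph (extracted_graph p q C) (extracted_graph p' q' C')"
    using same_descent_same_graph[OF assms L'] types unfolding cycle_of_type_def by metis
qed

end
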